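(* Let $n\ge1$ and let $f=\sum_{m\in(\mathbb{Z}/2^n\mathbb{Z})^\times}c_m\,\widehat{E}_2|S_{2^n,m}$ for some complex constants $c_m$, with $f\in\mathcal{M}_2(\Gamma_1(2^{2n}))$. Then $f\in\mathcal{M}_2(\Gamma_0(2^{2n}))$ if and only if $$f\in\operatorname{Span}\{\widehat{E}_2|S_{2^j,m}\ :\ j=1,\dots,\min(3,n),\ m\in(\mathbb{Z}/2^j\mathbb{Z})^\times\}.$$
   Context: $\widehat{E}_2(\tau)=1-\frac{3}{\pi\operatorname{Im}(\tau)}-24\sum_{n\ge1}\sigma_1(n)q^n$, $q=e^{2\pi i\tau}$, $\sigma_1(n)=\sum_{d\mid n}d$. For $M\in\mathbb{N}$ and $m\in\mathbb{Z}$, $\widehat{E}_2|S_{M,m}$ is the part of this expansion supported on indices $\equiv m\pmod M$ (the term $1-\frac{3}{\pi\operatorname{Im}\tau}$ having index $0$); for $m$ coprime to $M$ it equals $-24\sum_{k\equiv m\,(M)}\sigma_1(k)q^k$. $\mathcal{M}_2(\Gamma)$ denotes the space of holomorphic modular forms of weight $2$ on $\Gamma$; $\Gamma_0(N)$, $\Gamma_1(N)$ are the standard congruence subgroups ($c\equiv0\pmod N$; additionally $a\equiv1\pmod N$ for $\Gamma_1$). *)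

theory Defs
  imports
    "HOL-Complex_Analysis.Complex_Analysis"
    "HOL-Number_Theory.Number_Theory"
    "HOL-Library.Function_Algebras"
begin

definition upper_half_plane :: "complex set" where
  "upper_half_plane = {\<tau>. Im \<tau> > 0}"

definition SL2Z :: "(int ^ 2 ^ 2) set" where
  "SL2Z = {A. det A = 1}"

definition Gamma0 :: "nat \<Rightarrow> (int ^ 2 ^ 2) set" where
  "Gamma0 N = {A \<in> SL2Z. [A $ 2 $ 1 = 0] (mod int N)}"

text \<open>For elements of \<open>Gamma1 N\<close>, the determinant condition forces
  \<open>A $ 2 $ 2 \<equiv> 1\<close> modulo \<open>N\<close> as well.\<close>

definition Gamma1 :: "nat \<Rightarrow> (int ^ 2 ^ 2) set" where
  "Gamma1 N = {A \<in> Gamma0 N. [A $ 1 $ 1 = 1] (mod int N)}"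

definition slash :: "int \<Rightarrow> (complex \<Rightarrow> complex) \<Rightarrow> int ^ 2 ^ 2 \<Rightarrow> complex \<Rightarrow> complex" where
  "slash k f A \<tau> =
     (of_int (A $ 2 $ 1) * \<tau> + of_int (A $ 2 $ 2)) powi (- k) *
     f ((of_int (A $ 1 $ 1) * \<tau> + of_int (A $ 1 $ 2)) /
        (of_int (A $ 2 $ 1) * \<tau> + of_int (A $ 2 $ 2)))"

text \<open>A Fourier expansion in \<open>exp (2\<pi>i\<tau>/h)\<close>, for some period \<open>h\<close>, without negative exponents.\<close>

definition holomorphic_at_infinity :: "(complex \<Rightarrow> complex) \<Rightarrow> bool" where
  "holomorphic_at_infinity f \<longleftrightarrow>
     (\<exists>h::nat. h > 0 \<and> (\<exists>a :: nat \<Rightarrow> complex. \<forall>\<tau>\<in>upper_half_plane.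
        (\<lambda>n. a n * exp (2 * pi * \<i> * of_nat n * \<tau> / of_nat h)) sums f \<tau>))"

text \<open>Functions on the upper half plane are represented by total functions that vanish
  outside it, so that equality of functions is equality on the upper half plane.
  Holomorphy at all cusps is holomorphy at infinity of all \<open>SL2Z\<close>-translates.\<close>

definition modular_forms :: "int \<Rightarrow> (int ^ 2 ^ 2) set \<Rightarrow> (complex \<Rightarrow> complex) set" where
  "modular_forms k \<Gamma> = {f.
     (\<forall>\<tau>. \<tau> \<notin> upper_half_plane \<longrightarrow> f \<tau> = 0) \<and>
     f holomorphic_on upper_half_plane \<and>
     (\<forall>A\<in>\<Gamma>. \<forall>\<tau>\<in>upper_half_plane. slash k f A \<tau> = f \<tau>) \<and>
     (\<forall>A\<in>SL2Z. holomorphic_at_infinity (slash k f A))}"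

definition sigma1 :: "nat \<Rightarrow> nat" where
  "sigma1 n = (\<Sum>d | d dvd n. d)"

text \<open>The term of index \<open>n\<close> in the expansion
  \<open>(1 - 3 / (\<pi> Im \<tau>)) - 24 \<Sum>\<^sub>n\<^sub>\<ge>\<^sub>1 \<sigma>\<^sub>1(n) q\<^sup>n\<close> of the completed
  Eisenstein series of weight 2; the non-holomorphic part has index 0.\<close>

definition E2_hat_term :: "nat \<Rightarrow> complex \<Rightarrow> complex" where
  "E2_hat_term n \<tau> =
     (if n = 0 then 1 - 3 / (pi * of_real (Im \<tau>))
      else - 24 * of_nat (sigma1 n) * exp (2 * pi * \<i> * \<tau>) ^ n)"

definition E2_hat :: "complex \<Rightarrow> complex" where
  "E2_hat \<tau> = (if \<tau> \<in> upper_half_plane then (\<Sum>n. E2_hat_term n \<tau>) else 0)"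

definition E2_hat_sieve :: "nat \<Rightarrow> int \<Rightarrow> complex \<Rightarrow> complex" where
  "E2_hat_sieve M m \<tau> =
     (if \<tau> \<in> upper_half_plane
      then (\<Sum>n. if [int n = m] (mod int M) then E2_hat_term n \<tau> else 0) else 0)"

lemma E2_hat_sieve_1: "E2_hat_sieve 1 m = E2_hat"
  by (simp add: fun_eq_iff E2_hat_sieve_def E2_hat_def)

lemma E2_hat_sieve_coprime:
  assumes "coprime m (int M)" "M > 1" "\<tau> \<in> upper_half_plane"
  shows "E2_hat_sieve M m \<tau> = (\<Sum>n. if [int n = m] (mod int M)
           then - 24 * of_nat (sigma1 n) * exp (2 * pi * \<i> * \<tau>) ^ n else 0)"
proof -
  have "\<not> [int 0 = m] (mod int M)"
  proof
    assume "[int 0 = m] (mod int M)"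
    then have "int M dvd m"
      by (metis cong_0_iff cong_sym_eq of_nat_0)
    then have "is_unit (int M)"
      using assms(1) by (meson coprime_common_divisor dvd_refl)
    then show False
      using assms(2) by simp
  qed
  then have "(if [int n = m] (mod int M) then E2_hat_term n \<tau> else 0) =
      (if [int n = m] (mod int M)
       then - 24 * of_nat (sigma1 n) * exp (2 * pi * \<i> * \<tau>) ^ n else 0)" for n
    by (cases "n = 0") (auto simp: E2_hat_term_def)
  with assms(3) show ?thesis
    by (simp add: E2_hat_sieve_def)
qed

definition cfun_scale :: "complex \<Rightarrow> (complex \<Rightarrow> complex) \<Rightarrow> complex \<Rightarrow> complex" where
  "cfun_scale c f = (\<lambda>\<tau>. c * f \<tau>)"

interpretation cfun: vector_space cfun_scale
  by unfold_locales (auto simp: cfun_scale_def fun_eq_iff algebra_simps)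

end

theory Submission
  imports Defs
begin

text \<open>Only odd indices matter, so the role of the Eisenstein series is played by
  \<open>F(\<tau>) = \<Sum> \<sigma>\<^sub>1(n) q\<^sup>n\<close>, summed over odd \<open>n\<close>. By the Lipschitz formula (a derivative of the
  reflection formula for the Gamma function), \<open>- 4\<pi>\<^sup>2 F(\<tau>)\<close> is the sum at \<open>t = 2\<tau>\<close> of
  \<open>1/(ct + 2e)\<^sup>2 - 1/(ct + 2e + 1)\<^sup>2\<close> over odd \<open>c\<close> and all \<open>e\<close>. The pairing makes this double
  series converge absolutely; summed over \<open>c\<close> first, it is visibly covariant under
  \<open>t \<mapsto> t/(2t + 1)\<close>. Together with the period \<open>1\<close> this makes \<open>F\<close> modular of weight 2 on
  \<open>\<Gamma>\<^sub>0(4)\<close>, with no correction term.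

  The sieved series with residue \<open>m\<close> modulo \<open>M\<close> is a discrete Fourier combination of the shifts
  \<open>F(\<tau> + u/M)\<close>, and a matrix in \<open>\<Gamma>\<^sub>0(M\<^sup>2)\<close> with diagonal \<open>a, d\<close> maps it to the one with residue
  \<open>a\<^sup>2 m\<close>. By uniqueness of Fourier coefficients, \<open>f\<close> is invariant under \<open>\<Gamma>\<^sub>0(2\<^sup>2\<^sup>n)\<close> iff
  \<open>c\<close> is invariant under multiplication of its argument by odd squares. These are exactly the
  classes congruent to \<open>1\<close> modulo \<open>8\<close>, so this says that \<open>c\<close> only depends on \<open>m\<close> modulo \<open>8\<close>.\<close>

subsection \<open>Absolute convergence of the paired lattice sum\<close>

text \<open>The imaginary part controls \<open>c\<close>, and \<open>d = (c t + d) - c t\<close>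
  then controls \<open>d\<close>; the constant depends on \<open>t\<close> only.\<close>

lemma lattice_norm_lower_bound:
  assumes "Im t > 0"
  obtains K where "K > 0" "\<And>c d :: real. K * \<bar>c\<bar> \<le> norm (of_real c * t + of_real d)"
    "\<And>c d :: real. K * \<bar>d\<bar> \<le> norm (of_real c * t + of_real d)"
proof -
  define B where "B = 1 + norm t / Im t"
  define K where "K = min (Im t) (1 / B)"
  have B: "B > 0" unfolding B_def using assms by (simp add: add_pos_nonneg)
  have K: "K > 0" "K \<le> Im t" "K * B \<le> 1"
    using assms B by (auto simp: K_def field_simps min_def)
  have 1: "Im t * \<bar>c\<bar> \<le> norm (of_real c * t + of_real d)" for c d :: real
    using abs_Im_le_cmod[of "of_real c * t + of_real d"] assms by (simp add: abs_mult mult.commute)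
  have 2: "\<bar>d\<bar> \<le> B * norm (of_real c * t + of_real d)" (is "_ \<le> B * ?N") for c d :: real
  proof -
    have "\<bar>d\<bar> = norm ((of_real c * t + of_real d) - of_real c * t)" by simp
    also have "\<dots> \<le> ?N + \<bar>c\<bar> * norm t"
      by (metis norm_triangle_ineq4 norm_mult norm_of_real)
    also have "\<bar>c\<bar> \<le> ?N / Im t" using 1[of c d] assms by (simp add: field_simps)
    finally show ?thesis unfolding B_def using assms
      by (simp add: field_simps mult_right_mono)
  qed
  show thesis
  proof (rule that[of K])
    fix c d :: real
    show "K * \<bar>c\<bar> \<le> norm (of_real c * t + of_real d)"
      using 1[of c d] K by (meson abs_ge_zero mult_right_mono order_trans)
    have "K * \<bar>d\<bar> \<le> K * (B * norm (of_real c * t + of_real d))"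
      using 2[of d c] K by (intro mult_left_mono) auto
    also have "\<dots> = (K * B) * norm (of_real c * t + of_real d)" by simp
    also have "\<dots> \<le> 1 * norm (of_real c * t + of_real d)"
      using K by (intro mult_right_mono) auto
    finally show "K * \<bar>d\<bar> \<le> norm (of_real c * t + of_real d)" by simp
  qed (use K in auto)
qed

lemma has_sum_int_split:
  fixes f :: "int \<Rightarrow> 'a :: banach"
  assumes "((\<lambda>n. f (int n)) has_sum a) UNIV" "((\<lambda>n. f (- int (Suc n))) has_sum b) UNIV"
  shows "(f has_sum (a + b)) UNIV"
proof -
  have "bij_betw int UNIV {0..}"
    by (rule bij_betwI[of _ _ _ nat]) auto
  then have "(f has_sum a) {0..}"
    using assms(1) has_sum_reindex_bij_betw by blast
  moreover have "bij_betw (\<lambda>n. - int (Suc n)) UNIV {..<0}"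
    by (rule bij_betwI[of _ _ _ "\<lambda>k. nat (- k - 1)"]) auto
  then have "(f has_sum b) {..<0}"
    using assms(2) has_sum_reindex_bij_betw by blast
  ultimately have "(f has_sum (a + b)) ({0..} \<union> {..<0})"
    by (intro has_sum_Un_disjoint) auto
  also have "{0..} \<union> {..<0} = (UNIV :: int set)" by auto
  finally show ?thesis .
qed

text \<open>The \<open>max 1\<close> keeps the majorant positive at \<open>k = 0\<close>, where
  \<open>powr\<close> would return \<open>0\<close>.\<close>

lemma summable_on_max_powr:
  assumes "s > 1"
  shows "(\<lambda>k::int. max 1 \<bar>real_of_int k\<bar> powr (- s)) summable_on UNIV"
proof -
  have "summable (\<lambda>n. real (Suc n) powr (- s))"
    using assms by (subst summable_Suc_iff) (simp add: summable_real_powr_iff)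
  then have a: "(\<lambda>n. real (Suc n) powr (- s)) summable_on UNIV"
    by (intro summable_nonneg_imp_summable_on) auto
  have "summable (\<lambda>n. max 1 (real n) powr (- s))"
    by (rule summable_Suc_iff[THEN iffD1], use \<open>summable (\<lambda>n. real (Suc n) powr (- s))\<close> in \<open>simp add: max_def\<close>)
  then have b: "(\<lambda>n. max 1 (real n) powr (- s)) summable_on UNIV"
    by (intro summable_nonneg_imp_summable_on) auto
  from a obtain A where A: "((\<lambda>n. real (Suc n) powr (- s)) has_sum A) UNIV"
    by (auto simp: summable_on_def)
  from b obtain B where B: "((\<lambda>n. max 1 (real n) powr (- s)) has_sum B) UNIV"
    by (auto simp: summable_on_def)
  have "((\<lambda>k::int. max 1 \<bar>real_of_int k\<bar> powr (- s)) has_sum (B + A)) UNIV"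
    by (rule has_sum_int_split) (use A B in \<open>simp_all add: max_def add.commute\<close>)
  then show ?thesis by (auto simp: summable_on_def)
qed

text \<open>This splits cubic decay in the larger of two indices into a product of two powers with
  exponent \<open>3/2 > 1\<close>, each of them summable over the integers.\<close>

lemma powr_three_halves_mult_le:
  assumes "a > 0" "b > 0" "(N::real) \<ge> a" "N \<ge> b"
  shows "a powr (3/2) * b powr (3/2) \<le> N ^ 3"
proof -
  have "a powr (3/2) * b powr (3/2) \<le> N powr (3/2) * N powr (3/2)"
    using assms by (intro mult_mono powr_mono2) auto
  also have "\<dots> = N powr 3" by (simp flip: powr_add)
  also have "\<dots> = N ^ 3" using assms by (simp add: powr_numeral)
  finally show ?thesis .
qed

lemma summable_on_inverse_square:
  assumes "Im t > 0"
  shows "(\<lambda>k. 1 / (of_int k * t + of_int d) ^ 2) summable_on {k. odd k}"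
    and "(\<lambda>k. 1 / (t + of_int k) ^ 2) summable_on (UNIV :: int set)"
proof -
  obtain K where K: "K > 0" "\<And>c d :: real. K * \<bar>c\<bar> \<le> norm (of_real c * t + of_real d)"
    "\<And>c d :: real. K * \<bar>d\<bar> \<le> norm (of_real c * t + of_real d)"
    using lattice_norm_lower_bound[OF assms] by blast
  have *: "norm (1 / z ^ 2) \<le> (1 / K ^ 2) * max 1 \<bar>real_of_int k\<bar> powr (- 2)"
    if "K * max 1 \<bar>real_of_int k\<bar> \<le> norm z" for z :: complex and k
  proof -
    have "(K * max 1 \<bar>real_of_int k\<bar>) ^ 2 \<le> norm z ^ 2"
      using K that by (intro power_mono) auto
    then have "norm (1 / z ^ 2) \<le> 1 / (K * max 1 \<bar>real_of_int k\<bar>) ^ 2"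
      using K by (auto simp: norm_divide norm_power intro!: frac_le)
    then show ?thesis
      by (simp add: powr_minus powr_numeral field_simps power_mult_distrib)
  qed
  have s: "(\<lambda>k::int. (1 / K ^ 2) * max 1 \<bar>real_of_int k\<bar> powr (- 2)) summable_on A" for A
    by (intro summable_on_cmult_right summable_on_subset[OF summable_on_max_powr]) auto
  show "(\<lambda>k. 1 / (of_int k * t + of_int d) ^ 2) summable_on {k. odd k}"
    using Infinite_Sum.abs_summable_on_comparison_test'[OF s]
  proof (rule abs_summable_summable)
    fix k :: int assume "k \<in> {k. odd k}"
    then have "k \<noteq> 0" by auto
    then have "\<bar>real_of_int k\<bar> \<ge> 1" by linarith
    then show "norm (1 / (of_int k * t + of_int d) ^ 2) \<le> (1 / K ^ 2) * max 1 \<bar>real_of_int k\<bar> powr (- 2)"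
      using K(2)[of "real_of_int k" "real_of_int d"] by (intro *) (simp add: max_def)
  qed
  show "(\<lambda>k. 1 / (t + of_int k) ^ 2) summable_on (UNIV :: int set)"
    using Infinite_Sum.abs_summable_on_comparison_test'[OF s]
  proof (rule abs_summable_summable)
    fix k :: int
    show "norm (1 / (t + of_int k) ^ 2) \<le> (1 / K ^ 2) * max 1 \<bar>real_of_int k\<bar> powr (- 2)"
      using K(2)[of 1 "real_of_int k"] K(3)[of "real_of_int k" 1] by (intro *) (simp add: max_def)
  qed
qed

definition paired_term :: "complex \<Rightarrow> int \<Rightarrow> int \<Rightarrow> complex" where
  "paired_term t c e =
     1 / (of_int c * t + of_int (2 * e)) ^ 2 - 1 / (of_int c * t + of_int (2 * e + 1)) ^ 2"

text \<open>Over a common denominator the difference decays cubically instead of quadratically in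
  the larger index, which suffices in two dimensions.\<close>

lemma paired_term_summable:
  assumes "Im t > 0"
  shows "(\<lambda>(c, e). paired_term t c e) summable_on ({c. odd c} \<times> UNIV)"
proof -
  obtain K where K: "K > 0" "\<And>c d :: real. K * \<bar>c\<bar> \<le> norm (of_real c * t + of_real d)"
    "\<And>c d :: real. K * \<bar>d\<bar> \<le> norm (of_real c * t + of_real d)"
    using lattice_norm_lower_bound[OF assms] by blast
  define h :: "int \<Rightarrow> real" where "h = (\<lambda>k. max 1 \<bar>real_of_int k\<bar> powr (- (3/2)))"
  have h: "h summable_on UNIV" unfolding h_def by (rule summable_on_max_powr) simp
  have h0: "h k > 0" for k by (simp add: h_def)
  have hh: "(\<lambda>(c, e). h c * h e) summable_on ({c. odd c} \<times> UNIV)"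
  proof (rule summable_on_SigmaI)
    fix c
    show "((\<lambda>e. case (c, e) of (c, e) \<Rightarrow> h c * h e) has_sum h c * infsum h UNIV) UNIV"
      using h by (auto intro!: has_sum_cmult_right)
    show "(\<lambda>c. h c * infsum h UNIV) summable_on {c. odd c}"
      using h summable_on_subset by (intro summable_on_cmult_left) blast
  qed (use h0 in \<open>auto intro: less_imp_le\<close>)
  have s: "(\<lambda>x. (2 / K ^ 3) * (case x of (c, e) \<Rightarrow> h c * h e)) summable_on ({c. odd c} \<times> UNIV)"
    by (intro summable_on_cmult_right hh)
  show ?thesis using Infinite_Sum.abs_summable_on_comparison_test'[OF s]
  proof (rule abs_summable_summable)
    fix x :: "int \<times> int" assume x: "x \<in> {c. odd c} \<times> UNIV"
    obtain c e where ce: "x = (c, e)" by (cases x)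
    have "c \<noteq> 0" using x ce by auto
    then have c1: "\<bar>real_of_int c\<bar> \<ge> 1" by linarith
    define m where "m = max (max 1 \<bar>real_of_int c\<bar>) (max 1 \<bar>real_of_int e\<bar>)"
    define z where "z = of_int c * t + of_int (2 * e)"
    have m1: "m \<ge> 1" by (simp add: m_def)
    \<comment> \<open>Both \<open>2 * e\<close> and \<open>2 * e + 1\<close> have absolute value at
      least that of \<open>e\<close>, so one bound serves both denominators.\<close>
    have *: "K * m \<le> norm (of_int c * t + of_int d)" if "\<bar>d\<bar> \<ge> \<bar>e\<bar>" for d :: int
    proof -
      have "K * \<bar>real_of_int e\<bar> \<le> K * \<bar>real_of_int d\<bar>" using K that by (intro mult_left_mono) linarith+
      moreover have "K \<le> K * \<bar>real_of_int c\<bar>" using K c1 by simp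
      ultimately show ?thesis
        using K(2)[of "real_of_int c" "real_of_int d"] K(3)[of "real_of_int d" "real_of_int c"] c1
        unfolding m_def max_def by auto
    qed
    have z1: "K * m \<le> norm z" unfolding z_def by (rule *) auto
    have "K * m \<le> norm (of_int c * t + of_int (2 * e + 1))" by (rule *) arith
    then have z2: "K * m \<le> norm (z + 1)" by (simp add: z_def add_ac)
    have Km: "K * m > 0" "K > 0" "m > 0" using K m1 by simp_all
    have nz: "z \<noteq> 0" "z + 1 \<noteq> 0" using order_less_le_trans[OF Km(1) z1] order_less_le_trans[OF Km(1) z2] by auto
    have "paired_term t c e = 1 / z ^ 2 - 1 / (z + 1) ^ 2"
      by (simp add: paired_term_def z_def add_ac)
    \<comment> \<open>The numerator \<open>2 z + 1\<close> is written as
      \<open>z + (z + 1)\<close>.\<close>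
    also have "\<dots> = 1 / (z * (z + 1) ^ 2) + 1 / (z ^ 2 * (z + 1))"
      using nz by (simp add: divide_simps) (simp add: algebra_simps power2_eq_square)
    finally have eq: "paired_term t c e = 1 / (z * (z + 1) ^ 2) + 1 / (z ^ 2 * (z + 1))" .
    have "norm (1 / (z * (z + 1) ^ 2)) \<le> 1 / ((K * m) * (K * m) ^ 2)"
      unfolding norm_divide norm_mult norm_power norm_one
      using z1 z2 Km nz by (intro frac_le mult_mono power_mono mult_pos_pos zero_less_power) (auto simp: less_imp_le zero_le_power)
    moreover have "norm (1 / (z ^ 2 * (z + 1))) \<le> 1 / ((K * m) ^ 2 * (K * m))"
      unfolding norm_divide norm_mult norm_power norm_one
      using z1 z2 Km nz by (intro frac_le mult_mono power_mono mult_pos_pos zero_less_power) (auto simp: less_imp_le zero_le_power)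
    ultimately have "norm (paired_term t c e) \<le> 1 / ((K * m) * (K * m) ^ 2) + 1 / ((K * m) ^ 2 * (K * m))"
      unfolding eq by (intro order_trans[OF norm_triangle_ineq] add_mono)
    also have "\<dots> = (2 / K ^ 3) * (1 / m ^ 3)"
      using K m1 by (simp add: field_simps power2_eq_square power3_eq_cube)
    also have "\<dots> \<le> (2 / K ^ 3) * (1 / (max 1 \<bar>real_of_int c\<bar> powr (3/2) * max 1 \<bar>real_of_int e\<bar> powr (3/2)))"
      using K m1 by (intro mult_left_mono frac_le powr_three_halves_mult_le mult_pos_pos) (auto simp: m_def)
    also have "\<dots> = (2 / K ^ 3) * (h c * h e)"
      unfolding h_def by (simp only: powr_minus) (simp add: field_simps)
    finally show "norm (case x of (c, e) \<Rightarrow> paired_term t c e)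
        \<le> (2 / K ^ 3) * (case x of (c, e) \<Rightarrow> h c * h e)"
      by (simp add: ce)
  qed
qed

subsection \<open>The Lipschitz formula\<close>

text \<open>The logarithmic derivative of \<open>Gamma z * Gamma (1 - z) = pi / sin (pi z)\<close>
  is a reflection formula for \<open>Digamma\<close>; differentiating once more gives this
  one.\<close>

lemma Polygamma_1_reflection:
  fixes z :: complex
  assumes "z \<notin> \<int>"
  shows "Polygamma 1 z + Polygamma 1 (1 - z) = (of_real pi / sin (of_real pi * z)) ^ 2"
proof -
  have Z: "w \<notin> \<int>\<^sub>\<le>\<^sub>0" "1 - w \<notin> \<int>\<^sub>\<le>\<^sub>0" "sin (of_real pi * w) \<noteq> 0" if "w \<in> - \<int>" for w :: complex
  proof -
    show "w \<notin> \<int>\<^sub>\<le>\<^sub>0" using that nonpos_Ints_Int by auto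
    have "1 - w \<notin> \<int>" using that Ints_diff[of 1 "1 - w"] by auto
    then show "1 - w \<notin> \<int>\<^sub>\<le>\<^sub>0" using nonpos_Ints_Int by auto
    show "sin (of_real pi * w) \<noteq> 0"
    proof
      assume "sin (of_real pi * w) = 0"
      then obtain n :: int where "of_real pi * w = of_real (n * pi)"
        by (auto simp: Complex_Transcendental.sin_eq_0)
      then have "of_real pi * w = of_real pi * of_int n" by (simp add: mult.commute)
      then have "w = of_int n" by simp
      then show False using that by simp
    qed
  qed
  have op: "open (- \<int> :: complex set)" using closed_Ints by (simp add: open_Compl)
  have dig: "Digamma w - Digamma (1 - w) = - of_real pi * cot (of_real pi * w)" if "w \<in> - \<int>" for w :: complex
  proof -
    have "((\<lambda>w. Gamma w * Gamma (1 - w)) has_field_derivative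
            (Gamma w * Gamma (1 - w) * (Digamma w - Digamma (1 - w)))) (at w)"
      using Z[OF that] by (auto intro!: derivative_eq_intros simp: algebra_simps)
    moreover have "((\<lambda>w. Gamma w * Gamma (1 - w)) has_field_derivative
            (of_real pi / sin (of_real pi * w) * (- of_real pi * cot (of_real pi * w)))) (at w)"
      unfolding Gamma_reflection_complex
      using Z[OF that] by (auto intro!: derivative_eq_intros simp: cot_def field_simps)
    ultimately have "Gamma w * Gamma (1 - w) * (Digamma w - Digamma (1 - w)) =
        of_real pi / sin (of_real pi * w) * (- of_real pi * cot (of_real pi * w))"
      by (rule DERIV_unique)
    then show ?thesis using Z[OF that] unfolding Gamma_reflection_complex
      by (subst (asm) mult_left_cancel) auto
  qed
  have z: "z \<in> - \<int>" using assms by simp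
  have "((\<lambda>w. Digamma w - Digamma (1 - w)) has_field_derivative
      (Polygamma 1 z + Polygamma 1 (1 - z))) (at z)"
    using Z[OF z] by (auto intro!: derivative_eq_intros)
  \<comment> \<open>The cotangent identity holds on the open set of non-integers, so the derivative
    may be computed on the cotangent side.\<close>
  moreover have "((\<lambda>w. Digamma w - Digamma (1 - w)) has_field_derivative
      (of_real pi / sin (of_real pi * z)) ^ 2) (at z)"
  proof (rule has_field_derivative_transform_within_open[OF _ op z])
    have "((\<lambda>w. of_real pi * w) has_field_derivative of_real pi) (at z)"
      by (auto intro!: derivative_eq_intros)
    from DERIV_cmult[OF DERIV_chain2[OF DERIV_cot[OF Z(3)[OF z]] this], of "- of_real pi"]
    show "((\<lambda>w. - of_real pi * cot (of_real pi * w)) has_field_derivative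
        (of_real pi / sin (of_real pi * z)) ^ 2) (at z)"
      by (simp add: field_simps power2_eq_square)
  qed (use dig in simp)
  ultimately show ?thesis by (rule DERIV_unique)
qed

text \<open>The indices \<open>k >= 0\<close> give the series of \<open>Polygamma 1 z\<close>. The
  index \<open>k = - (n + 1)\<close> gives \<open>(z - n - 1)^2 = ((1 - z) + n)^2\<close>, hence the
  series at \<open>1 - z\<close>.\<close>

lemma has_sum_inverse_square_shifts_pos:
  assumes "Im z > 0"
  shows "((\<lambda>k::int. 1 / (z + of_int k) ^ 2) has_sum (of_real pi / sin (of_real pi * z)) ^ 2) UNIV"
proof -
  have z: "z \<notin> \<int>" using assms by (auto elim!: Ints_cases)
  then have "1 - z \<notin> \<int>" using Ints_diff[of 1 "1 - z"] by auto
  then have nz: "z \<noteq> 0" "1 - z \<noteq> 0" using z by auto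
  have S: "(\<lambda>k::int. 1 / (z + of_int k) ^ 2) summable_on UNIV"
    using summable_on_inverse_square(2)[OF assms] .
  have P: "(\<lambda>k. inverse ((w + of_nat k) ^ 2)) sums Polygamma 1 w" if "w \<noteq> 0" for w :: complex
    using Polygamma_LIMSEQ[OF that, of 1] by (simp add: numeral_2_eq_2)
  have a: "((\<lambda>n. 1 / (z + of_int (int n)) ^ 2) has_sum Polygamma 1 z) UNIV"
  proof -
    have "(\<lambda>n. 1 / (z + of_int (int n)) ^ 2) summable_on UNIV"
      using summable_on_subset[OF S, of "range int"] by (simp add: summable_on_reindex o_def)
    then obtain a where a: "((\<lambda>n. 1 / (z + of_int (int n)) ^ 2) has_sum a) UNIV"
      by (auto simp: summable_on_def)
    then have "a = Polygamma 1 z"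
      using has_sum_imp_sums[OF a] P[OF nz(1)] by (auto simp: inverse_eq_divide intro: sums_unique2)
    with a show ?thesis by simp
  qed
  have b: "((\<lambda>n. 1 / (z + of_int (- int (Suc n))) ^ 2) has_sum Polygamma 1 (1 - z)) UNIV"
  proof -
    have "inj (\<lambda>n. - int (Suc n))" by (auto simp: inj_on_def)
    then have "(\<lambda>n. 1 / (z + of_int (- int (Suc n))) ^ 2) summable_on UNIV"
      using summable_on_subset[OF S, of "range (\<lambda>n. - int (Suc n))"]
      by (simp only: summable_on_reindex o_def subset_UNIV)
    then obtain b where b: "((\<lambda>n. 1 / (z + of_int (- int (Suc n))) ^ 2) has_sum b) UNIV"
      by (auto simp: summable_on_def)
    have "(z + of_int (- int (Suc n))) ^ 2 = ((1 - z) + of_nat n) ^ 2" for n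
      by (subst power2_commute[of "1 - z" "- of_nat n", simplified]) (simp add: power2_eq_square algebra_simps)
    then have "b = Polygamma 1 (1 - z)"
      using has_sum_imp_sums[OF b] P[OF nz(2)] by (auto simp: inverse_eq_divide intro: sums_unique2)
    with b show ?thesis by simp
  qed
  have "Polygamma 1 z + Polygamma 1 (1 - z) = (of_real pi / sin (of_real pi * z)) ^ 2"
    by (rule Polygamma_1_reflection[OF z])
  with has_sum_int_split[OF a b] show ?thesis by simp
qed

text \<open>Both sides are even in \<open>z\<close>. The lower half plane is needed for the rows of
  the lattice sum with negative \<open>c\<close>.\<close>

lemma has_sum_inverse_square_shifts:
  assumes "Im z \<noteq> 0"
  shows "((\<lambda>k::int. 1 / (z + of_int k) ^ 2) has_sum (of_real pi / sin (of_real pi * z)) ^ 2) UNIV"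
proof (cases "Im z > 0")
  case False
  then have "((\<lambda>k::int. 1 / (- z + of_int k) ^ 2) has_sum (of_real pi / sin (of_real pi * z)) ^ 2) UNIV"
    using has_sum_inverse_square_shifts_pos[of "- z"] assms by (simp add: power_divide)
  moreover have "bij_betw uminus (UNIV :: int set) UNIV"
    by (rule bij_betwI[of _ _ _ uminus]) auto
  ultimately have "((\<lambda>k::int. 1 / (- z + of_int (- k)) ^ 2) has_sum (of_real pi / sin (of_real pi * z)) ^ 2) UNIV"
    by (subst has_sum_reindex_bij_betw[of uminus UNIV UNIV "\<lambda>k. 1 / (- z + of_int k) ^ 2"]) auto
  moreover have "(- z + of_int (- k)) ^ 2 = (z + of_int k) ^ 2" for k
    by (simp add: power2_eq_square algebra_simps)
  ultimately show ?thesis by simp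
qed (rule has_sum_inverse_square_shifts_pos)

text \<open>This is the closed form of the sum of \<open>(-1)^d / (w + d)^2\<close> over all
  integers \<open>d\<close>: even \<open>d\<close> give the sine, odd \<open>d\<close> the
  cosine.\<close>

definition row_sum :: "complex \<Rightarrow> complex" where
  "row_sum w = ((of_real pi / sin (of_real pi * (w / 2))) ^ 2 - (of_real pi / cos (of_real pi * (w / 2))) ^ 2) / 4"

lemma row_sum_minus: "row_sum (- w) = row_sum w"
  by (simp add: row_sum_def)

lemma has_sum_row:
  assumes "Im w \<noteq> 0"
  shows "((\<lambda>e. 1 / (w + of_int (2 * e)) ^ 2 - 1 / (w + of_int (2 * e + 1)) ^ 2) has_sum row_sum w) UNIV"
proof -
  have "((\<lambda>e::int. 1 / (w / 2 + of_int e) ^ 2 / 4) has_sum (of_real pi / sin (of_real pi * (w / 2))) ^ 2 / 4) UNIV"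
    by (intro has_sum_divide_const has_sum_inverse_square_shifts) (use assms in simp)
  moreover have "(w + of_int (2 * e)) ^ 2 = (w / 2 + of_int e) ^ 2 * 4" for e
    by (simp add: power2_eq_square field_simps)
  ultimately have 1: "((\<lambda>e::int. 1 / (w + of_int (2 * e)) ^ 2) has_sum (of_real pi / sin (of_real pi * (w / 2))) ^ 2 / 4) UNIV"
    by (simp only: divide_divide_eq_left)
  have "((\<lambda>e::int. 1 / ((w + 1) / 2 + of_int e) ^ 2 / 4) has_sum (of_real pi / sin (of_real pi * ((w + 1) / 2))) ^ 2 / 4) UNIV"
    by (intro has_sum_divide_const has_sum_inverse_square_shifts) (use assms in simp)
  moreover have "(w + of_int (2 * e + 1)) ^ 2 = ((w + 1) / 2 + of_int e) ^ 2 * 4" for e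
    by (simp add: power2_eq_square field_simps)
  \<comment> \<open>Odd \<open>d\<close> amount to a shift of \<open>w / 2\<close> by one half,
    which turns sine into cosine.\<close>
  moreover have "sin (of_real pi * ((w + 1) / 2)) = cos (of_real pi * (w / 2))"
  proof -
    have "of_real pi * ((w + 1) / 2) = of_real pi * (w / 2) + of_real pi / 2" by (simp add: field_simps)
    then show ?thesis by (simp only: sin_add) simp
  qed
  ultimately have 2: "((\<lambda>e::int. 1 / (w + of_int (2 * e + 1)) ^ 2) has_sum (of_real pi / cos (of_real pi * (w / 2))) ^ 2 / 4) UNIV"
    by (simp only: divide_divide_eq_left)
  from has_sum_add[OF 1 has_sum_uminusI[OF 2]] show ?thesis by (simp add: row_sum_def diff_divide_distrib)
qed

text \<open>With \<open>x = exp (pi i w)\<close>, half the difference of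
  \<open>y / (1 - y)^2\<close> at \<open>y = x\<close> and \<open>y = - x\<close> keeps the odd
  powers; both squares in \<open>row_sum\<close> are rational functions of \<open>x\<close>.\<close>

lemma row_sum_sums:
  assumes "Im w > 0"
  shows "(\<lambda>k. (if odd k then of_nat k * exp (pi * \<i> * w) ^ k else 0)) sums (- row_sum w / (2 * pi ^ 2))"
proof -
  define x where "x = exp (pi * \<i> * w)"
  have x: "norm x < 1" using assms by (simp add: x_def)
  have D: "(\<lambda>k. of_nat k * y ^ k) sums (y / (1 - y) ^ 2)" if "norm y < 1" for y :: complex
  proof -
    have "(\<lambda>k. of_nat (Suc k) * y ^ Suc k) sums (y * (1 / (1 - y) ^ 2))"
      using sums_mult[OF geometric_deriv_sums[OF that], of y] by (simp add: algebra_simps)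
    then show ?thesis by (subst (asm) sums_Suc_iff) simp
  qed
  have "(\<lambda>k. (of_nat k * x ^ k - of_nat k * (- x) ^ k) / 2) sums ((x / (1 - x) ^ 2 - (- x) / (1 - (- x)) ^ 2) / 2)"
    by (intro sums_divide sums_diff D) (use x in auto)
  moreover have "(of_nat k * x ^ k - of_nat k * (- x) ^ k) / 2 = (if odd k then of_nat k * x ^ k else 0)" for k
    by auto
  moreover have "(x / (1 - x) ^ 2 - (- x) / (1 - (- x)) ^ 2) / 2 = - row_sum w / (2 * pi ^ 2)"
  proof -
    \<comment> \<open>A square root of \<open>x\<close>, in which sine and cosine of
      \<open>pi w / 2\<close> are rational.\<close>
    define y where "y = exp (\<i> * (pi * (w / 2)))"
    have y0: "y \<noteq> 0" by (simp add: y_def)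
    have xy: "x = y ^ 2" by (simp add: x_def y_def flip: exp_double) (simp add: algebra_simps)
    have s: "sin (of_real pi * (w / 2)) = (y - 1 / y) / (2 * \<i>)"
      unfolding sin_exp_eq y_def by (simp add: exp_minus inverse_eq_divide)
    have c: "cos (of_real pi * (w / 2)) = (y + 1 / y) / 2"
      unfolding cos_exp_eq y_def by (simp add: exp_minus inverse_eq_divide)
    have "(of_real pi / sin (of_real pi * (w / 2))) ^ 2 = - 4 * pi ^ 2 * (x / (1 - x) ^ 2)"
    proof -
      have "(y - 1 / y) = (x - 1) / y" using y0 by (simp add: xy field_simps power2_eq_square)
      then have "sin (of_real pi * (w / 2)) = (x - 1) / (2 * \<i> * y)"
        using s by (simp only: divide_divide_eq_left mult_ac)
      then have "(of_real pi / sin (of_real pi * (w / 2))) = of_real pi * 2 * \<i> * y / (x - 1)"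
        by (simp only: divide_divide_eq_right mult_ac)
      then have "(of_real pi / sin (of_real pi * (w / 2))) ^ 2 = - 4 * pi ^ 2 * x / (x - 1) ^ 2"
        by (simp add: power_divide power_mult_distrib xy)
      then show ?thesis by (simp add: power2_commute)
    qed
    moreover have "(of_real pi / cos (of_real pi * (w / 2))) ^ 2 = 4 * pi ^ 2 * (x / (1 + x) ^ 2)"
    proof -
      have "(y + 1 / y) = (x + 1) / y" using y0 by (simp add: xy field_simps power2_eq_square)
      then have "(of_real pi / cos (of_real pi * (w / 2))) = of_real pi * 2 * y / (x + 1)"
        unfolding c by simp
      then have "(of_real pi / cos (of_real pi * (w / 2))) ^ 2 = 4 * pi ^ 2 * x / (x + 1) ^ 2"
        by (simp add: power_divide power_mult_distrib xy)
      then show ?thesis by (simp add: add.commute)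
    qed
    ultimately show ?thesis unfolding row_sum_def
      by (simp add: diff_divide_distrib add_divide_distrib)
  qed
  ultimately have "(\<lambda>k. if odd k then of_nat k * x ^ k else 0) sums (- row_sum w / (2 * pi ^ 2))"
    by (simp only:)
  then show ?thesis unfolding x_def .
qed

subsection \<open>Modularity of the odd part of the Eisenstein series\<close>

lemma sigma1_le: "sigma1 n \<le> n ^ 2"
proof (cases "n = 0")
  case False
  then have "{d. d dvd n} \<subseteq> {1..n}" by (auto intro: dvd_imp_le Suc_leI)
  then have "sigma1 n \<le> (\<Sum>d\<in>{1..n}. d)" unfolding sigma1_def by (intro sum_mono2) auto
  also have "\<dots> \<le> (\<Sum>d\<in>{1..n}. n)" by (intro sum_mono) auto
  finally show ?thesis by (simp add: power2_eq_square)
qed (simp add: sigma1_def)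

text \<open>Since \<open>sigma1 n <= n^2\<close>, the series is dominated by the second derivative
  of the geometric series, with coefficients \<open>(n + 1) (n + 2)\<close>.\<close>

lemma summable_sigma1:
  fixes x :: complex
  assumes x: "norm x < 1" and C: "\<And>n. norm (C n) \<le> B"
  shows "summable (\<lambda>n. norm (C n * of_nat (sigma1 n) * x ^ n))"
proof -
  have "summable (\<lambda>n. diffs (diffs (\<lambda>_. 1)) n * norm x ^ n)"
    using x by (intro termdiff_converges[of _ 1]) auto
  then have "summable (\<lambda>n. B * ((real n + 1) * (real n + 2) * norm x ^ n))"
    by (intro summable_mult) (simp add: diffs_def add_ac mult_ac)
  then show ?thesis
  proof (rule summable_comparison_test[rotated], intro exI[of _ 0] allI impI)
    fix n
    have "real (sigma1 n) \<le> real (n ^ 2)" using sigma1_le by (simp only: of_nat_le_iff)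
    also have "\<dots> \<le> (real n + 1) * (real n + 2)" by (simp add: power2_eq_square algebra_simps)
    finally have 1: "real (sigma1 n) \<le> (real n + 1) * (real n + 2)" .
    have B: "B \<ge> 0" using C[of 0] norm_ge_zero order_trans by blast
    have "norm (C n) * real (sigma1 n) * norm x ^ n \<le> B * ((real n + 1) * (real n + 2)) * norm x ^ n"
      using 1 C B by (intro mult_right_mono mult_mono) auto
    then show "norm (norm (C n * of_nat (sigma1 n) * x ^ n)) \<le> B * ((real n + 1) * (real n + 2) * norm x ^ n)"
      by (simp add: norm_mult norm_power mult_ac)
  qed
qed

lemma summable_norm_odd:
  "summable (\<lambda>n. norm (f n)) \<Longrightarrow> summable (\<lambda>n. norm (if odd n then f n else 0))"
  by (rule summable_comparison_test) auto

lemma has_sum_oddI: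
  fixes f :: "nat \<Rightarrow> 'a :: banach"
  assumes "summable (\<lambda>n. norm (f n))" "(\<lambda>n. if odd n then f n else 0) sums S"
  shows "(f has_sum S) {n. odd n}"
proof -
  have "((\<lambda>n. if odd n then f n else 0) has_sum S) UNIV"
    using assms by (intro norm_summable_imp_has_sum summable_norm_odd)
  also have "?this \<longleftrightarrow> ?thesis"
    by (rule has_sum_cong_neutral) auto
  finally show ?thesis .
qed

lemma has_sum_row_sum_odd:
  assumes "Im w > 0"
  shows "((\<lambda>k. of_nat k * exp (pi * \<i> * w) ^ k) has_sum (- row_sum w / (2 * pi ^ 2))) {k. odd k}"
proof (rule has_sum_oddI[OF _ row_sum_sums[OF assms]])
  define r where "r = norm (exp (pi * \<i> * w))"
  have "norm r < 1" using assms by (simp add: r_def)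
  then have "summable (\<lambda>k. of_nat (Suc k) * r ^ k)"
    using geometric_deriv_sums by (blast intro: sums_summable)
  then have "summable (\<lambda>k. r * (of_nat (Suc k) * r ^ k))" by (rule summable_mult)
  then have "summable (\<lambda>k. of_nat (Suc k) * r ^ Suc k)" by (simp add: algebra_simps)
  then have "summable (\<lambda>k. of_nat k * r ^ k)" by (subst (asm) summable_Suc_iff)
  then show "summable (\<lambda>k. norm (of_nat k * exp (pi * \<i> * w) ^ k))"
    by (simp add: norm_mult norm_power r_def)
qed

definition odd_sigma_series :: "complex \<Rightarrow> complex" where
  "odd_sigma_series \<tau> = (\<Sum>n. if odd n then of_nat (sigma1 n) * exp (2 * pi * \<i> * \<tau>) ^ n else 0)"

lemma norm_exp_less_1: "Im \<tau> > 0 \<Longrightarrow> norm (exp (2 * pi * \<i> * \<tau>)) < 1"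
  by simp

lemma has_sum_odd_sigma_series:
  assumes "Im \<tau> > 0"
  shows "((\<lambda>n. of_nat (sigma1 n) * exp (2 * pi * \<i> * \<tau>) ^ n) has_sum odd_sigma_series \<tau>) {n. odd n}"
proof (rule has_sum_oddI)
  show s: "summable (\<lambda>n. norm (of_nat (sigma1 n) * exp (2 * pi * \<i> * \<tau>) ^ n))"
    using summable_sigma1[OF norm_exp_less_1[OF assms], of "\<lambda>_. 1" 1] by (simp only: mult_1 norm_one order_refl)
  show "(\<lambda>n. if odd n then of_nat (sigma1 n) * exp (2 * pi * \<i> * \<tau>) ^ n else 0) sums odd_sigma_series \<tau>"
    unfolding odd_sigma_series_def by (rule summable_sums[OF summable_norm_cancel[OF summable_norm_odd[OF s]]])
qed

text \<open>Writing \<open>sigma1 n\<close> as a sum over divisors and \<open>n = m k\<close> with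
  the divisor \<open>k\<close> makes a double sum over odd \<open>m\<close> and \<open>k\<close>;
  its inner sum over \<open>k\<close> is the Lipschitz formula at \<open>2 m \<tau>\<close>.\<close>

lemma has_sum_odd_sigma_lambert:
  assumes "Im \<tau> > 0"
  shows "((\<lambda>m. - row_sum (of_nat m * (2 * \<tau>)) / (2 * pi ^ 2)) has_sum odd_sigma_series \<tau>) {m. odd m}"
proof -
  define q where "q = exp (2 * pi * \<i> * \<tau>)"
  define g where "g = (\<lambda>(n::nat, d::nat). of_nat d * q ^ n)"
  define D where "D = (SIGMA n:{n. odd n}. {d. d dvd (n::nat)})"
  have fin: "finite {d. d dvd (n::nat)}" if "n \<in> {n. odd n}" for n
    using that by (intro finite_divisors_nat) (auto elim: oddE)
  \<comment> \<open>The norms over the divisors of \<open>n\<close> add up to the norm of the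
    \<open>n\<close>-th term of the original series, so absolute convergence carries over.\<close>
  have "(\<lambda>x. norm (g x)) summable_on D"
    unfolding D_def
  proof (subst Infinite_Sum.abs_summable_on_Sigma_iff, intro conjI ballI)
    fix n :: nat assume n: "n \<in> {n. odd n}"
    then show "(\<lambda>y. norm (g (n, y))) summable_on {d. d dvd n}" using fin by simp
  next
    have "infsum (\<lambda>y. norm (g (n, y))) {d. d dvd n} = norm (of_nat (sigma1 n) * q ^ n)" if "n \<in> {n. odd n}" for n
    proof -
      have "infsum (\<lambda>y. norm (g (n, y))) {d. d dvd n} = (\<Sum>d | d dvd n. real d * norm (q ^ n))"
        using fin[OF that] by (simp add: g_def norm_mult)
      also have "\<dots> = real (sigma1 n) * norm (q ^ n)"
        by (simp add: sigma1_def sum_distrib_right)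
      finally show ?thesis by (simp add: norm_mult)
    qed
    moreover have "(\<lambda>n. of_nat (sigma1 n) * q ^ n) summable_on {n. odd n}"
      unfolding q_def by (rule has_sum_imp_summable[OF has_sum_odd_sigma_series[OF assms]])
    then have "(\<lambda>n. norm (of_nat (sigma1 n) * q ^ n)) summable_on {n. odd n}"
      by (rule summable_on_iff_abs_summable_on_complex[THEN iffD1])
    ultimately show "(\<lambda>n. norm (infsum (\<lambda>y. norm (g (n, y))) {d. d dvd n})) summable_on {n. odd n}"
      by (subst summable_on_cong) auto
  qed
  then have "g summable_on D" by (rule abs_summable_summable)
  then have "(g has_sum odd_sigma_series \<tau>) D"
    unfolding D_def
  proof (rule has_sum_SigmaI[rotated 2])
    show "((\<lambda>n. of_nat (sigma1 n) * q ^ n) has_sum odd_sigma_series \<tau>) {n. odd n}"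
      unfolding q_def by (rule has_sum_odd_sigma_series[OF assms])
    fix n :: nat assume n: "n \<in> {n. odd n}"
    show "((\<lambda>y. g (n, y)) has_sum of_nat (sigma1 n) * q ^ n) {d. d dvd n}"
      using fin[OF n] by (intro has_sum_finiteI) (simp_all add: g_def sigma1_def sum_distrib_right)
  qed
  moreover have "bij_betw (\<lambda>(m, k). (m * k, k)) ({m. odd m} \<times> {k. odd k}) D"
  proof (rule bij_betwI[of _ _ _ "\<lambda>(n, d). (n div d, d)"])
    show "(\<lambda>(n, d). (n div d, d)) \<in> D \<rightarrow> {m. odd m} \<times> {k. odd k}"
    proof
      fix x assume "x \<in> D"
      then obtain n k where nk: "x = (n, k)" "odd n" "k dvd n" by (auto simp: D_def)
      moreover from nk(3) obtain m where "n = k * m" ..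
      ultimately have "x = (k * m, k)" "odd (k * m)" by simp_all
      moreover from this have "k \<noteq> 0" by (intro notI) simp
      ultimately show "(case x of (n, d) \<Rightarrow> (n div d, d)) \<in> {m. odd m} \<times> {k. odd k}" by simp
    qed
  qed (auto simp: D_def dest: odd_pos)
  ultimately have "((\<lambda>x. g (case x of (m, k) \<Rightarrow> (m * k, k))) has_sum odd_sigma_series \<tau>) ({m. odd m} \<times> {k. odd k})"
    by (subst has_sum_reindex_bij_betw)
  then show ?thesis
  proof (rule has_sum_SigmaD)
    fix m :: nat assume "m \<in> {m. odd m}"
    then have "Im (of_nat m * (2 * \<tau>)) > 0" using assms by (auto elim: oddE)
    note * = has_sum_row_sum_odd[OF this]
    have "exp (pi * \<i> * (of_nat m * (2 * \<tau>))) = q ^ m"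
      unfolding q_def exp_of_nat_mult[symmetric] by (simp add: mult_ac)
    with * show "((\<lambda>k. g (case (m, k) of (m, k) \<Rightarrow> (m * k, k))) has_sum - row_sum (of_nat m * (2 * \<tau>)) / (2 * pi ^ 2)) {k. odd k}"
      by (simp only: g_def prod.case power_mult)
  qed
qed

section \<open>Row and column summation of the paired lattice sum\<close>

definition paired_sum :: "complex \<Rightarrow> complex" where
  "paired_sum t = infsum (\<lambda>(c, e). paired_term t c e) ({c. odd c} \<times> UNIV)"

lemma has_sum_paired_sum:
  assumes "Im t > 0"
  shows "((\<lambda>(c, e). paired_term t c e) has_sum paired_sum t) ({c. odd c} \<times> UNIV)"
  unfolding paired_sum_def by (intro has_sum_infsum paired_term_summable assms)

lemma has_sum_paired_sum_rows:
  assumes "Im t > 0"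
  shows "((\<lambda>c. row_sum (of_int c * t)) has_sum paired_sum t) {c. odd c}"
proof (rule has_sum_SigmaD[OF has_sum_paired_sum[OF assms]])
  fix c :: int assume "c \<in> {c. odd c}"
  then have "c \<noteq> 0" by auto
  then show "((\<lambda>e. case (c, e) of (c, e) \<Rightarrow> paired_term t c e) has_sum row_sum (of_int c * t)) UNIV"
    unfolding prod.case paired_term_def using assms by (intro has_sum_row) simp
qed

definition column_sum :: "complex \<Rightarrow> int \<Rightarrow> complex" where
  "column_sum t d = infsum (\<lambda>c. 1 / (of_int c * t + of_int d) ^ 2) {c. odd c}"

text \<open>Summing over \<open>c\<close> first, which absolute convergence permits, isolates a
  quantity for each \<open>d\<close> on which the Moebius substitution acts separately.\<close>

lemma has_sum_paired_sum_columns: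
  assumes "Im t > 0"
  shows "((\<lambda>e. column_sum t (2 * e) - column_sum t (2 * e + 1)) has_sum paired_sum t) UNIV"
proof -
  have "((\<lambda>(e, c). paired_term t c e) has_sum paired_sum t) (UNIV \<times> {c. odd c})"
    using has_sum_paired_sum[OF assms] by (subst has_sum_swap) simp
  then show ?thesis
  proof (rule has_sum_SigmaD)
    fix e :: int
    have *: "((\<lambda>c. 1 / (of_int c * t + of_int d) ^ 2) has_sum column_sum t d) {c. odd c}" for d
      unfolding column_sum_def by (intro has_sum_infsum summable_on_inverse_square assms)
    show "((\<lambda>c. case (e, c) of (e, c) \<Rightarrow> paired_term t c e) has_sum
        column_sum t (2 * e) - column_sum t (2 * e + 1)) {c. odd c}"
      using has_sum_add[OF *[of "2 * e"] has_sum_uminusI[OF *[of "2 * e + 1"]]] by (simp add: paired_term_def)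
  qed
qed

text \<open>The rows \<open>c\<close> and \<open>- c\<close> agree because \<open>row_sum\<close> is
  even, so each half contributes the Lambert series and the constant doubles to
  \<open>- 4 pi^2\<close>.\<close>

lemma paired_sum_eq:
  assumes "Im \<tau> > 0"
  shows "paired_sum (2 * \<tau>) = - 4 * pi ^ 2 * odd_sigma_series \<tau>"
proof -
  define S where "S = - 2 * pi ^ 2 * odd_sigma_series \<tau>"
  have S: "((\<lambda>m. row_sum (of_nat m * (2 * \<tau>))) has_sum S) {m. odd m}"
    using has_sum_cmult_right[OF has_sum_odd_sigma_lambert[OF assms], of "- 2 * pi ^ 2"]
    by (simp add: S_def)
  have "bij_betw int {m. odd m} {c. odd c \<and> c > 0}"
    by (rule bij_betwI[of _ _ _ nat]) (auto simp: even_nat_iff intro: odd_pos)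
  then have 1: "((\<lambda>c. row_sum (of_int c * (2 * \<tau>))) has_sum S) {c. odd c \<and> c > 0}"
    using S has_sum_reindex_bij_betw[of int _ _ "\<lambda>c. row_sum (of_int c * (2 * \<tau>))"] by simp
  have "bij_betw (\<lambda>m. - int m) {m. odd m} {c. odd c \<and> c < 0}"
    by (rule bij_betwI[of _ _ _ "\<lambda>c. nat (- c)"]) (auto simp: even_nat_iff intro: odd_pos)
  then have 2: "((\<lambda>c. row_sum (of_int c * (2 * \<tau>))) has_sum S) {c. odd c \<and> c < 0}"
    using S has_sum_reindex_bij_betw[of "\<lambda>m. - int m" _ _ "\<lambda>c. row_sum (of_int c * (2 * \<tau>))"]
    by (simp add: row_sum_minus)
  have "((\<lambda>c. row_sum (of_int c * (2 * \<tau>))) has_sum (S + S)) ({c. odd c \<and> c > 0} \<union> {c. odd c \<and> c < 0})"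
    by (intro has_sum_Un_disjoint 1 2) auto
  also have "{c. odd c \<and> c > 0} \<union> {c. odd c \<and> c < 0} = {c :: int. odd c}" by (auto simp: not_less order_le_less)
  finally have "paired_sum (2 * \<tau>) = S + S"
    using has_sum_paired_sum_rows[of "2 * \<tau>"] assms has_sum_unique by fastforce
  then show ?thesis by (simp add: S_def)
qed

lemma moebius_upper_half_plane:
  assumes "Im t > 0" "a * d - b * c = (1 :: int)"
  shows "of_int c * t + of_int d \<noteq> 0" "Im ((of_int a * t + of_int b) / (of_int c * t + of_int d)) > 0"
proof -
  show nz: "of_int c * t + of_int d \<noteq> 0"
  proof
    assume *: "of_int c * t + of_int d = 0"
    then have "Im (of_int c * t + of_int d) = 0" by simp
    then have "c = 0" using assms(1) by simp
    then show False using * assms(2) by simp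
  qed
  have ad: "real_of_int a * of_int d - of_int b * of_int c = 1"
    using assms(2) by (metis of_int_1 of_int_diff of_int_mult)
  have "Im ((of_int a * t + of_int b) / (of_int c * t + of_int d)) = 
     (real_of_int a * of_int d - of_int b * of_int c) * Im t / norm (of_int c * t + of_int d) ^ 2"
    unfolding Im_divide cmod_power2 by (simp add: algebra_simps)
  then show "Im ((of_int a * t + of_int b) / (of_int c * t + of_int d)) > 0"
    using ad assms(1) nz by simp
qed

text \<open>The substitution fixes \<open>d\<close> and replaces \<open>c\<close> by
  \<open>c + 2 d\<close>, which permutes the odd integers; only the automorphy factor
  remains.\<close>

lemma column_sum_transform:
  assumes "2 * t + 1 \<noteq> 0"
  shows "column_sum (t / (2 * t + 1)) d = (2 * t + 1) ^ 2 * column_sum t d"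
proof -
  have eq: "(2 * t + 1) ^ 2 * (1 / (of_int (c + 2 * d) * t + of_int d) ^ 2) =
      1 / (of_int c * (t / (2 * t + 1)) + of_int d) ^ 2" for c :: int
  proof -
    have "of_int c * (t / (2 * t + 1)) + of_int d = (of_int (c + 2 * d) * t + of_int d) / (2 * t + 1)"
      using assms by (simp add: field_simps)
    then show ?thesis by (simp add: power_divide)
  qed
  have "bij_betw (\<lambda>c. c + 2 * d) {c. odd c} {c. odd c}"
    by (rule bij_betwI[of _ _ _ "\<lambda>c. c - 2 * d"]) auto
  then have "column_sum t d = infsum (\<lambda>c. 1 / (of_int (c + 2 * d) * t + of_int d) ^ 2) {c. odd c}"
    unfolding column_sum_def by (rule infsum_reindex_bij_betw[symmetric])
  then have "(2 * t + 1) ^ 2 * column_sum t d =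
      infsum (\<lambda>c. (2 * t + 1) ^ 2 * (1 / (of_int (c + 2 * d) * t + of_int d) ^ 2)) {c. odd c}"
    by (simp only: infsum_cmult_right')
  then show ?thesis unfolding eq by (simp add: column_sum_def)
qed

lemma paired_sum_transform:
  assumes "Im t > 0"
  shows "paired_sum (t / (2 * t + 1)) = (2 * t + 1) ^ 2 * paired_sum t"
proof -
  have "2 * t + 1 \<noteq> 0" "Im (t / (2 * t + 1)) > 0"
    using moebius_upper_half_plane[OF assms, of 1 1 0 2] by simp_all
  then show ?thesis
    using has_sum_paired_sum_columns[of "t / (2 * t + 1)"]
      has_sum_cmult_right[OF has_sum_paired_sum_columns[OF assms], of "(2 * t + 1) ^ 2"]
    by (simp add: column_sum_transform has_sum_unique flip: right_diff_distrib)
qed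

lemma odd_sigma_series_add_int: "odd_sigma_series (\<tau> + of_int k) = odd_sigma_series \<tau>"
proof -
  have "2 * pi * \<i> * (\<tau> + of_int k) = 2 * pi * \<i> * \<tau> + \<i> * (of_int k * (of_real pi * 2))"
    by (simp add: algebra_simps)
  then show ?thesis by (simp only: odd_sigma_series_def exp_plus_2pin)
qed

text \<open>At \<open>t = 2 \<tau>\<close> the substitution \<open>t / (2 t + 1)\<close> becomes
  \<open>\<tau> / (4 \<tau> + 1)\<close>, and the constant \<open>- 4 pi^2\<close> cancels.\<close>

lemma odd_sigma_series_transform:
  assumes "Im \<tau> > 0"
  shows "odd_sigma_series (\<tau> / (4 * \<tau> + 1)) = (4 * \<tau> + 1) ^ 2 * odd_sigma_series \<tau>"
proof -
  have *: "4 * \<tau> + 1 \<noteq> 0" "Im (\<tau> / (4 * \<tau> + 1)) > 0"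
    using moebius_upper_half_plane[OF assms, of 1 1 0 4] by simp_all
  have "2 * \<tau> / (2 * (2 * \<tau>) + 1) = 2 * (\<tau> / (4 * \<tau> + 1))" by simp
  then have "paired_sum (2 * (\<tau> / (4 * \<tau> + 1))) = (4 * \<tau> + 1) ^ 2 * paired_sum (2 * \<tau>)"
    using paired_sum_transform[of "2 * \<tau>"] assms by simp
  then have "(- 4 * of_real pi ^ 2) * odd_sigma_series (\<tau> / (4 * \<tau> + 1)) =
      (- 4 * of_real pi ^ 2) * ((4 * \<tau> + 1) ^ 2 * odd_sigma_series \<tau>)"
    unfolding paired_sum_eq[OF *(2)] paired_sum_eq[OF assms] by (simp add: mult_ac)
  then show ?thesis by (subst (asm) mult_left_cancel) auto
qed

text \<open>The inverse substitution: the previous law is applied at \<open>z\<close>, where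
  \<open>4 z + 1\<close> is the reciprocal of \<open>1 - 4 \<tau>\<close>.\<close>

lemma odd_sigma_series_transform':
  assumes "Im \<tau> > 0"
  shows "odd_sigma_series (\<tau> / (1 - 4 * \<tau>)) = (1 - 4 * \<tau>) ^ 2 * odd_sigma_series \<tau>"
proof -
  define z where "z = \<tau> / (1 - 4 * \<tau>)"
  have *: "1 - 4 * \<tau> \<noteq> 0" "Im z > 0"
    using moebius_upper_half_plane[OF assms, of 1 1 0 "-4"] by (simp_all add: z_def)
  have e: "4 * z + 1 = 1 / (1 - 4 * \<tau>)" using * by (simp add: z_def field_simps)
  have "z / (4 * z + 1) = \<tau>" unfolding e using * by (simp add: z_def)
  then have "odd_sigma_series \<tau> = (1 / (1 - 4 * \<tau>)) ^ 2 * odd_sigma_series z"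
    using odd_sigma_series_transform[OF *(2)] by (simp add: e)
  then show ?thesis using * by (simp add: z_def power_divide)
qed

text \<open>Descent on the bottom row: \<open>d\<close> is odd and \<open>4\<close> divides \<open>c\<close>, so \<open>2\<bar>d\<bar> \<noteq> \<bar>c\<bar>\<close>, and
  a step \<open>d \<mapsto> d \<plusminus> c\<close> or \<open>c \<mapsto> c \<plusminus> 4d\<close> lowers \<open>\<bar>c\<bar> + \<bar>d\<bar>\<close>.\<close>

theorem odd_sigma_series_modular:
  assumes "a * d - b * c = (1 :: int)" "4 dvd c" "Im \<tau> > 0"
  shows "odd_sigma_series ((of_int a * \<tau> + of_int b) / (of_int c * \<tau> + of_int d)) =
    (of_int c * \<tau> + of_int d) ^ 2 * odd_sigma_series \<tau>"
  using assms
proof (induction "nat (\<bar>c\<bar> + \<bar>d\<bar>)" arbitrary: a b c d \<tau> rule: less_induct)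
  case less
  note IH = less.hyps and prems = less.prems
  have "odd d"
  proof
    assume "even d"
    moreover have "even c" using prems(2) by (meson dvd_trans even_numeral)
    ultimately have "even (a * d - b * c)" by simp
    then show False using prems(1) by simp
  qed
  consider "c = 0" | "c \<noteq> 0" "\<bar>c\<bar> < 2 * \<bar>d\<bar>" | "2 * \<bar>d\<bar> < \<bar>c\<bar>" | "\<bar>c\<bar> = 2 * \<bar>d\<bar>" by linarith
  then show ?case
  proof cases
    case 1
    then have "a * d = 1" using prems(1) by simp
    \<comment> \<open>The sign disappears in the even weight.\<close>
    then have "a = 1 \<and> d = 1 \<or> a = -1 \<and> d = -1" by (simp add: zmult_eq_1_iff)
    then show ?thesis
    proof
      assume "a = -1 \<and> d = -1"
      then show ?thesis using odd_sigma_series_add_int[of \<tau> "- b"] 1 by (simp add: field_simps)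
    next
      assume "a = 1 \<and> d = 1"
      then show ?thesis using odd_sigma_series_add_int[of \<tau> b] 1 by simp
    qed
  next
    case 2
    \<comment> \<open>This sign gives \<open>k c\<close> the sign of \<open>d\<close>. The induction
      hypothesis is applied to the matrix times \<open>(1, - k; 0, 1)\<close>, at the point
      \<open>\<tau> + k\<close>.\<close>
    define k where "k = sgn c * sgn d"
    have k: "\<bar>d - k * c\<bar> < \<bar>d\<bar>" using 2 by (auto simp: k_def sgn_if)
    have "Im (\<tau> + of_int k) > 0" using prems(3) by simp
    have "odd_sigma_series ((of_int a * (\<tau> + of_int k) + of_int (b - k * a)) / (of_int c * (\<tau> + of_int k) + of_int (d - k * c))) =
      (of_int c * (\<tau> + of_int k) + of_int (d - k * c)) ^ 2 * odd_sigma_series (\<tau> + of_int k)"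
      by (rule IH) (use k prems in \<open>auto simp: algebra_simps\<close>)
    moreover have "of_int a * (\<tau> + of_int k) + of_int (b - k * a) = of_int a * \<tau> + of_int b"
      "of_int c * (\<tau> + of_int k) + of_int (d - k * c) = of_int c * \<tau> + of_int d"
      by (simp_all add: algebra_simps)
    ultimately show ?thesis by (simp only: odd_sigma_series_add_int)
  next
    case 3
    define k where "k = sgn c * sgn d"
    have "d \<noteq> 0" using \<open>odd d\<close> by auto
    then have k: "\<bar>c - 4 * k * d\<bar> < \<bar>c\<bar>" using 3 by (auto simp: k_def sgn_if)
    have k1: "k = 1 \<or> k = -1" using \<open>d \<noteq> 0\<close> 3 by (auto simp: k_def sgn_if)
    define J where "J = of_int (4 * k) * \<tau> + 1"
    define z where "z = \<tau> / J"
    have nz: "J \<noteq> 0" "Im z > 0"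
      using moebius_upper_half_plane[OF prems(3), of 1 1 0 "4 * k"] by (simp_all add: z_def J_def)
    have T: "odd_sigma_series z = J ^ 2 * odd_sigma_series \<tau>"
      using k1 odd_sigma_series_transform[OF prems(3)] odd_sigma_series_transform'[OF prems(3)]
      by (auto simp: z_def J_def add.commute)
    have eq: "of_int (x - 4 * k * y) * z + of_int y = (of_int x * \<tau> + of_int y) / J" for x y
    proof -
      have "of_int (x - 4 * k * y) * z + of_int y = (of_int (x - 4 * k * y) * \<tau> + of_int y * J) / J"
        using nz by (simp add: z_def add_divide_distrib)
      also have "of_int (x - 4 * k * y) * \<tau> + of_int y * J = of_int x * \<tau> + of_int y"
        by (simp add: J_def algebra_simps)
      finally show ?thesis .
    qed
    \<comment> \<open>The induction hypothesis is applied to the matrix times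
      \<open>(1, 0; - 4 k, 1)\<close>, at the point \<open>z\<close>, whose automorphy factor
      \<open>J\<close> is already known.\<close>
    have "odd_sigma_series ((of_int (a - 4 * k * b) * z + of_int b) / (of_int (c - 4 * k * d) * z + of_int d)) =
      (of_int (c - 4 * k * d) * z + of_int d) ^ 2 * odd_sigma_series z"
    proof (rule IH)
      show "(a - 4 * k * b) * d - b * (c - 4 * k * d) = 1" using prems(1) by (simp add: algebra_simps)
      show "4 dvd c - 4 * k * d" using prems(2) by (simp add: mult.assoc)
    qed (use k nz in auto)
    then have "odd_sigma_series (((of_int a * \<tau> + of_int b) / J) / ((of_int c * \<tau> + of_int d) / J)) =
      ((of_int c * \<tau> + of_int d) / J) ^ 2 * (J ^ 2 * odd_sigma_series \<tau>)"
      by (simp only: eq T)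
    then show ?thesis using nz by (simp add: power_divide)
  next
    case 4
    from prems(2) obtain m where "c = 4 * m" by auto
    with 4 have "even d" by presburger
    with \<open>odd d\<close> show ?thesis by simp
  qed
qed

subsection \<open>Sieved Eisenstein series\<close>

text \<open>All shifted, sieved and combined series are of this form, so linear relations between
  them become relations between coefficient sequences.\<close>

definition sigma_series :: "(nat \<Rightarrow> complex) \<Rightarrow> complex \<Rightarrow> complex" where
  "sigma_series C \<tau> = (\<Sum>n. C n * of_nat (sigma1 n) * exp (2 * pi * \<i> * \<tau>) ^ n)"

lemma sums_sigma_series:
  assumes "Im \<tau> > 0" "\<And>n. norm (C n) \<le> B"
  shows "(\<lambda>n. C n * of_nat (sigma1 n) * exp (2 * pi * \<i> * \<tau>) ^ n) sums sigma_series C \<tau>"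
  unfolding sigma_series_def
  by (rule summable_sums[OF summable_norm_cancel[OF summable_sigma1[OF norm_exp_less_1]]]) (rule assms)+

lemma sigma_series_sum:
  assumes "Im \<tau> > 0" "\<And>i n. i \<in> I \<Longrightarrow> norm (C i n) \<le> B i"
  shows "(\<Sum>i\<in>I. a i * sigma_series (C i) \<tau>) = sigma_series (\<lambda>n. \<Sum>i\<in>I. a i * C i n) \<tau>"
proof -
  have "(\<lambda>n. \<Sum>i\<in>I. a i * (C i n * of_nat (sigma1 n) * exp (2 * pi * \<i> * \<tau>) ^ n)) sums
      (\<Sum>i\<in>I. a i * sigma_series (C i) \<tau>)"
    using assms by (intro sums_sum sums_mult sums_sigma_series)
  moreover have "(\<Sum>i\<in>I. a i * (C i n * of_nat (sigma1 n) * x)) = (\<Sum>i\<in>I. a i * C i n) * of_nat (sigma1 n) * x" for n x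
    by (simp only: sum_distrib_right mult.assoc)
  ultimately show ?thesis by (simp only: sigma_series_def sums_iff)
qed

lemma sigma_series_cmult:
  assumes "Im \<tau> > 0" "\<And>n. norm (C n) \<le> B"
  shows "a * sigma_series C \<tau> = sigma_series (\<lambda>n. a * C n) \<tau>"
  using sigma_series_sum[of \<tau> "{()}" "\<lambda>_. C" "\<lambda>_. B" "\<lambda>_. a"] assms by simp

lemma odd_sigma_series_shift:
  "odd_sigma_series (\<tau> + x) = sigma_series (\<lambda>n. of_bool (odd n) * exp (2 * pi * \<i> * x) ^ n) \<tau>"
proof -
  have "exp (2 * pi * \<i> * (\<tau> + x)) = exp (2 * pi * \<i> * x) * exp (2 * pi * \<i> * \<tau>)"
    by (simp add: algebra_simps flip: exp_add)
  then have "(if odd n then of_nat (sigma1 n) * exp (2 * pi * \<i> * (\<tau> + x)) ^ n else 0) =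
      of_bool (odd n) * exp (2 * pi * \<i> * x) ^ n * of_nat (sigma1 n) * exp (2 * pi * \<i> * \<tau>) ^ n" for n
    by (simp only: power_mult_distrib) (simp add: mult_ac)
  then show ?thesis unfolding odd_sigma_series_def sigma_series_def by presburger
qed

text \<open>Orthogonality of additive characters modulo \<open>M\<close>: a geometric sum whose
  ratio \<open>w\<close> satisfies \<open>w^M = 1\<close>, and \<open>w = 1\<close> exactly if
  \<open>M\<close> divides \<open>k\<close>.\<close>

lemma sum_roots_of_unity:
  assumes "M > 0"
  shows "(\<Sum>u<M. exp (2 * pi * \<i> * (of_nat u * of_int k / of_nat M))) = (if int M dvd k then of_nat M else 0)"
proof -
  define w where "w = exp (2 * pi * \<i> * (of_int k / of_nat M))"
  have pw: "exp (2 * pi * \<i> * (of_nat u * of_int k / of_nat M)) = w ^ u" for u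
    unfolding w_def exp_of_nat_mult[symmetric] by (simp add: mult_ac)
  have w1: "w = 1 \<longleftrightarrow> int M dvd k"
  proof -
    define r where "r = real_of_int k / real M"
    have "w = exp (of_real (r * (2 * pi)) * \<i>)" by (simp add: w_def r_def mult_ac)
    then have "w = 1 \<longleftrightarrow> (\<exists>n::int. r * (2 * pi) = of_int (2 * n) * pi)"
      by (simp add: exp_eq_1)
    also have "of_int (2 * n) * pi = of_int n * (2 * pi)" for n by simp
    then have "(\<exists>n::int. r * (2 * pi) = of_int (2 * n) * pi) \<longleftrightarrow> (\<exists>n::int. r = of_int n)"
      by (simp only: mult_cancel_right) simp
    also have "\<dots> \<longleftrightarrow> (\<exists>n::int. real_of_int k = real_of_int (n * int M))"
      using assms by (simp add: r_def field_simps)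
    also have "\<dots> \<longleftrightarrow> int M dvd k"
      by (simp only: of_int_eq_iff) (auto simp: dvd_def mult.commute)
    finally show ?thesis .
  qed
  have "w ^ M = exp (2 * pi * \<i> * of_int k)"
    using assms by (simp add: pw[symmetric])
  also have "\<dots> = 1"
    using exp_integer_2pi[of "of_int k"] by (simp add: mult_ac)
  finally have "w ^ M = 1" .
  then show ?thesis unfolding pw
    using w1 by (auto simp: geometric_sum)
qed

text \<open>Even \<open>n\<close> are absent on the right because \<open>D n\<close> is then even while \<open>m\<close> is odd.\<close>

lemma sum_twisted_odd_sigma_series:
  fixes D m :: int
  assumes "Im \<tau> > 0" "even M" "M > 0" "odd m"
  shows "(\<Sum>u<M. exp (2 * pi * \<i> * (- of_int m * of_nat u / of_nat M)) *
        odd_sigma_series (\<tau> + of_nat u * of_int D / of_nat M)) =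
      of_nat M * sigma_series (\<lambda>n. of_bool [D * int n = m] (mod int M)) \<tau>"
proof -
  have "norm (of_bool (odd n) * exp (2 * pi * \<i> * (of_nat u * of_int D / of_nat M)) ^ n) \<le> 1" for u n
    by (simp add: norm_mult norm_power)
  then have "(\<Sum>u<M. exp (2 * pi * \<i> * (- of_int m * of_nat u / of_nat M)) *
        odd_sigma_series (\<tau> + of_nat u * of_int D / of_nat M)) =
      sigma_series (\<lambda>n. \<Sum>u<M. exp (2 * pi * \<i> * (- of_int m * of_nat u / of_nat M)) *
        (of_bool (odd n) * exp (2 * pi * \<i> * (of_nat u * of_int D / of_nat M)) ^ n)) \<tau>"
    unfolding odd_sigma_series_shift by (intro sigma_series_sum[OF assms(1)])
  also have "(\<lambda>n. \<Sum>u<M. exp (2 * pi * \<i> * (- of_int m * of_nat u / of_nat M)) *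
        (of_bool (odd n) * exp (2 * pi * \<i> * (of_nat u * of_int D / of_nat M)) ^ n)) =
      (\<lambda>n. of_nat M * of_bool [D * int n = m] (mod int M))"
  proof
    fix n
    have "exp (2 * pi * \<i> * (- of_int m * of_nat u / of_nat M)) *
        (of_bool (odd n) * exp (2 * pi * \<i> * (of_nat u * of_int D / of_nat M)) ^ n) =
        of_bool (odd n) * exp (2 * pi * \<i> * (of_nat u * of_int (D * int n - m) / of_nat M))" for u
      unfolding exp_of_nat_mult[symmetric] mult.left_commute[of "exp _" "of_bool _"] exp_add[symmetric]
      by (simp add: diff_divide_distrib algebra_simps)
    then have "(\<Sum>u<M. exp (2 * pi * \<i> * (- of_int m * of_nat u / of_nat M)) *
        (of_bool (odd n) * exp (2 * pi * \<i> * (of_nat u * of_int D / of_nat M)) ^ n)) =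
        of_bool (odd n) * (if int M dvd D * int n - m then of_nat M else 0)"
      by (simp only: sum_distrib_left[symmetric] sum_roots_of_unity[OF assms(3)])
    moreover have "odd n" if "int M dvd D * int n - m"
    proof -
      have "even (D * int n - m)" using that assms(2) by (meson dvd_trans even_of_nat)
      then show ?thesis using assms(4) by auto
    qed
    ultimately show "(\<Sum>u<M. exp (2 * pi * \<i> * (- of_int m * of_nat u / of_nat M)) *
        (of_bool (odd n) * exp (2 * pi * \<i> * (of_nat u * of_int D / of_nat M)) ^ n)) =
        of_nat M * of_bool [D * int n = m] (mod int M)"
      by (auto simp: cong_iff_dvd_diff)
  qed
  also have "sigma_series \<dots> \<tau> = of_nat M * sigma_series (\<lambda>n. of_bool [D * int n = m] (mod int M)) \<tau>"
    by (rule sigma_series_cmult[of _ _ 1, symmetric]) (use assms in auto)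
  finally show ?thesis .
qed

text \<open>An odd \<open>m\<close> is never congruent to \<open>0\<close> modulo an even
  \<open>M\<close>, so the term of index \<open>0\<close> with the non-holomorphic part drops
  out.\<close>

lemma E2_hat_sieve_eq_sigma_series:
  assumes "Im \<tau> > 0" "even M" "odd m"
  shows "E2_hat_sieve M m \<tau> = - 24 * sigma_series (\<lambda>n. of_bool [int n = m] (mod int M)) \<tau>"
proof -
  have "\<not> [0 = m] (mod int M)"
    using assms by (metis cong_dvd_iff cong_iff_dvd_diff cong_0_iff cong_sym_eq dvd_trans even_of_nat)
  then have "(if [int n = m] (mod int M) then E2_hat_term n \<tau> else 0) =
      - 24 * of_bool [int n = m] (mod int M) * of_nat (sigma1 n) * exp (2 * pi * \<i> * \<tau>) ^ n" for n
    by (simp add: E2_hat_term_def)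
  then have "E2_hat_sieve M m \<tau> = sigma_series (\<lambda>n. - 24 * of_bool [int n = m] (mod int M)) \<tau>"
    using assms(1) by (simp add: E2_hat_sieve_def upper_half_plane_def sigma_series_def)
  also have "\<dots> = - 24 * sigma_series (\<lambda>n. of_bool [int n = m] (mod int M)) \<tau>"
    by (rule sigma_series_cmult[of _ _ 1, symmetric]) (use assms in auto)
  finally show ?thesis .
qed

text \<open>With \<open>u' = u d\<^sup>2\<close>, the matrix \<open>(1, u/M; 0, 1) A (1, - u'/M; 0, 1)\<close> is integral for
  \<open>A \<in> \<Gamma>\<^sub>0(M\<^sup>2)\<close>, and it again lies in \<open>\<Gamma>\<^sub>0(M\<^sup>2)\<close>.\<close>

lemma odd_sigma_series_shift_modular:
  fixes a b c d u :: int
  assumes det: "a * d - b * (int M ^ 2 * c) = 1" and M: "even M" "M > 0" and \<tau>: "Im \<tau> > 0"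
  defines "j \<equiv> of_int (int M ^ 2 * c) * \<tau> + of_int d"
  shows "odd_sigma_series ((of_int a * \<tau> + of_int b) / j + of_int u / of_nat M) =
    j ^ 2 * odd_sigma_series (\<tau> + of_int u * of_int (d ^ 2) / of_nat M)"
proof -
  define N where "N = int M"
  define z where "z = \<tau> + of_int u * of_int (d ^ 2) / of_nat M"
  have N: "of_nat M = of_int N" "(of_int N :: complex) \<noteq> 0" using M by (simp_all add: N_def)
  have det': "of_int a * of_int d - of_int b * (of_int N ^ 2 * of_int c) = (1 :: complex)"
    using arg_cong[OF det, of of_int] by (simp add: N_def)
  have j0: "j \<noteq> 0" unfolding j_def using moebius_upper_half_plane[OF \<tau> det] by simp
  have j: "of_int (N ^ 2 * c) * z + of_int (d - u * d ^ 2 * N * c) = j"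
    unfolding j_def z_def N using N(2) by (simp add: N_def[symmetric] field_simps power2_eq_square)
  \<comment> \<open>The contributions with denominator \<open>N\<close> are grouped as a multiple of
    the determinant, which is \<open>1\<close>.\<close>
  have "of_int (a + u * N * c) * z + of_int (b - u * d * b * N * c - u ^ 2 * d ^ 2 * c) =
      of_int a * \<tau> + of_int b + of_int u * of_int N * of_int c * \<tau>
        + of_int u * of_int d * (of_int a * of_int d - of_int b * (of_int N ^ 2 * of_int c)) / of_int N"
    unfolding z_def N using N(2) by (simp add: field_simps power2_eq_square)
  also have "\<dots> = of_int a * \<tau> + of_int b + of_int u * j / of_int N"
    unfolding det' j_def using N(2) by (simp add: N_def[symmetric] field_simps power2_eq_square)
  finally have num: "of_int (a + u * N * c) * z + of_int (b - u * d * b * N * c - u ^ 2 * d ^ 2 * c) =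
      of_int a * \<tau> + of_int b + of_int u * j / of_int N" .
  have "(a + u * N * c) * (d - u * d ^ 2 * N * c) - (b - u * d * b * N * c - u ^ 2 * d ^ 2 * c) * (N ^ 2 * c)
      = (a * d - b * (N ^ 2 * c)) + u * N * c * d * (1 - (a * d - b * (N ^ 2 * c)))"
    by (simp add: algebra_simps power2_eq_square)
  also have "\<dots> = 1" using det by (simp add: N_def)
  finally have det1: "(a + u * N * c) * (d - u * d ^ 2 * N * c) - (b - u * d * b * N * c - u ^ 2 * d ^ 2 * c) * (N ^ 2 * c) = 1" .
  \<comment> \<open>Evenness of \<open>M\<close> puts the matrix into level \<open>4\<close>, where
    the odd series is modular.\<close>
  have "2 ^ 2 dvd N ^ 2" using M by (intro dvd_power_same) (simp add: N_def)
  then have dvd: "4 dvd N ^ 2 * c" by simp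
  have "Im z > 0"
  proof -
    have "z = \<tau> + of_real (of_int u * of_int (d ^ 2) / of_nat M)" by (simp add: z_def)
    then have "Im z = Im \<tau>" by (simp only: plus_complex.sel Im_complex_of_real)
    then show ?thesis using \<tau> by simp
  qed
  from odd_sigma_series_modular[OF det1 dvd this]
  have "odd_sigma_series ((of_int a * \<tau> + of_int b + of_int u * j / of_int N) / j) = j ^ 2 * odd_sigma_series z"
    by (simp only: num j)
  moreover have "(of_int a * \<tau> + of_int b + of_int u * j / of_int N) / j = (of_int a * \<tau> + of_int b) / j + of_int u / of_nat M"
    using j0 by (simp add: N add_divide_distrib)
  ultimately show ?thesis by (simp add: z_def)
qed

text \<open>The sieve is expanded into shifts by \<open>u / M\<close>, each of which
  \<open>A\<close> moves to the shift by \<open>u d^2 / M\<close>; with the same characters these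
  reassemble to the condition \<open>d^2 n = m\<close> modulo \<open>M\<close>.\<close>

lemma slash_E2_hat_sieve:
  fixes A :: "int ^ 2 ^ 2"
  assumes A: "A \<in> Gamma0 (M ^ 2)" and M: "even M" "M > 0" and m: "odd m" and \<tau>: "Im \<tau> > 0"
  shows "slash 2 (E2_hat_sieve M m) A \<tau> =
    - 24 * sigma_series (\<lambda>n. of_bool [(A $ 2 $ 2) ^ 2 * int n = m] (mod int M)) \<tau>"
proof -
  define a b d where "a = A $ 1 $ 1" and "b = A $ 1 $ 2" and "d = A $ 2 $ 2"
  have "[A $ 2 $ 1 = 0] (mod int M ^ 2)" using A by (simp add: Gamma0_def)
  then obtain c where c: "A $ 2 $ 1 = int M ^ 2 * c" by (auto simp: cong_0_iff)
  have det: "a * d - b * (int M ^ 2 * c) = 1"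
    using A c by (simp add: Gamma0_def SL2Z_def det_2 a_def b_def d_def)
  define j where "j = of_int (int M ^ 2 * c) * \<tau> + of_int d"
  define z where "z = (of_int a * \<tau> + of_int b) / j"
  have j0: "j \<noteq> 0" and z: "Im z > 0"
    unfolding j_def z_def using moebius_upper_half_plane[OF \<tau> det] by auto
  have "of_nat M * sigma_series (\<lambda>n. of_bool [int n = m] (mod int M)) z =
      (\<Sum>u<M. exp (2 * pi * \<i> * (- of_int m * of_nat u / of_nat M)) *
        odd_sigma_series (z + of_nat u / of_nat M))"
    using sum_twisted_odd_sigma_series[OF z M m, of 1] by simp
  also have "\<dots> = (\<Sum>u<M. exp (2 * pi * \<i> * (- of_int m * of_nat u / of_nat M)) *
        (j ^ 2 * odd_sigma_series (\<tau> + of_nat u * of_int (d ^ 2) / of_nat M)))"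
    using odd_sigma_series_shift_modular[OF det M \<tau>, of "int _"]
    by (simp only: z_def j_def of_int_of_nat_eq)
  also have "\<dots> = j ^ 2 * (\<Sum>u<M. exp (2 * pi * \<i> * (- of_int m * of_nat u / of_nat M)) *
        odd_sigma_series (\<tau> + of_nat u * of_int (d ^ 2) / of_nat M))"
    by (simp only: sum_distrib_left mult.left_commute)
  also have "\<dots> = j ^ 2 * (of_nat M * sigma_series (\<lambda>n. of_bool [d ^ 2 * int n = m] (mod int M)) \<tau>)"
    by (simp only: sum_twisted_odd_sigma_series[OF \<tau> M m])
  finally have "sigma_series (\<lambda>n. of_bool [int n = m] (mod int M)) z =
      j ^ 2 * sigma_series (\<lambda>n. of_bool [d ^ 2 * int n = m] (mod int M)) \<tau>"
    using M by simp
  moreover have "slash 2 (E2_hat_sieve M m) A \<tau> = inverse (j ^ 2) * E2_hat_sieve M m z"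
    unfolding slash_def c j_def z_def a_def b_def d_def by (simp add: power_int_minus)
  ultimately show ?thesis
    using j0 by (simp add: E2_hat_sieve_eq_sigma_series[OF z M(1) m] d_def)
qed

section \<open>Uniqueness of the Fourier coefficients\<close>

lemma sigma1_pos: "n > 0 \<Longrightarrow> sigma1 n > 0"
  unfolding sigma1_def by (rule sum_pos2[of _ n]) auto

text \<open>Every nonzero \<open>z\<close> in the unit disc is \<open>exp (2 pi i \<tau>)\<close>
  with \<open>Im \<tau> > 0\<close>, so the two power series agree near \<open>0\<close>, and
  \<open>sigma1 n > 0\<close> can be cancelled.\<close>

lemma sigma_series_eq_imp:
  assumes eq: "\<And>\<tau>. Im \<tau> > 0 \<Longrightarrow> sigma_series C \<tau> = sigma_series C' \<tau>"
    and C: "\<And>n. norm (C n) \<le> B" and C': "\<And>n. norm (C' n) \<le> B'" and n: "n > 0"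
  shows "C n = C' n"
proof -
  define F where "F = (\<lambda>C. Abs_fps (\<lambda>n. C n * of_nat (sigma1 n) :: complex))"
  have rad: "fps_conv_radius (F C) > 0" if "\<And>n. norm (C n) \<le> B" for C B
  proof -
    have "summable (\<lambda>n. C n * of_nat (sigma1 n) * (1 / 2) ^ n)"
      by (rule summable_norm_cancel[OF summable_sigma1[OF _ that]]) (simp add: norm_divide)
    then have "fps_conv_radius (F C) \<ge> norm (1 / 2 :: complex)"
      unfolding fps_conv_radius_def F_def fps_nth_Abs_fps by (rule conv_radius_geI)
    moreover have "ereal (norm (1 / 2 :: complex)) > 0" by simp
    ultimately show ?thesis by (rule less_le_trans[rotated])
  qed
  have "F C = F C'"
  proof (rule eval_fps_eqD[OF rad[OF C] rad[OF C']])
    have "eval_fps (F C) z = eval_fps (F C') z" if z: "z \<in> ball 0 1" for z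
    proof (cases "z = 0")
      case True
      \<comment> \<open>Both constant terms vanish: the divisors of \<open>0\<close> form an
        infinite set, over which the sum defining \<open>sigma1 0\<close> is \<open>0\<close> by
        convention.\<close>
      then show ?thesis by (simp add: eval_fps_at_0 F_def sigma1_def)
    next
      case False
      define \<tau> where "\<tau> = Ln z / (2 * pi * \<i>)"
      have e: "exp (2 * pi * \<i> * \<tau>) = z" using False by (simp add: \<tau>_def)
      have "norm z < 1" using z by simp
      then have "ln (norm z) < 0" using False by simp
      then have "Im \<tau> > 0" using False by (simp add: \<tau>_def Im_divide power2_eq_square zero_less_mult_iff divide_less_0_iff)
      then have "sigma_series C \<tau> = sigma_series C' \<tau>" by (rule eq)
      then show ?thesis by (simp only: sigma_series_def e eval_fps_def F_def fps_nth_Abs_fps)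
    qed
    moreover have "eventually (\<lambda>z. z \<in> ball 0 1) (nhds (0::complex))"
      by (intro eventually_nhds_in_open) auto
    ultimately show "eventually (\<lambda>z. eval_fps (F C) z = eval_fps (F C') z) (nhds 0)"
      by (auto elim: eventually_mono)
  qed
  then have "fps_nth (F C) n = fps_nth (F C') n" by simp
  then show ?thesis using sigma1_pos[OF n] by (simp add: F_def)
qed

section \<open>Combinations of sieves over odd residues\<close>

lemma Units_residue_ring_power_2:
  assumes "k \<ge> 1"
  shows "Units (residue_ring (2 ^ k)) = {m. 0 < m \<and> m < 2 ^ k \<and> odd m}"
proof -
  interpret residues "2 ^ k" "residue_ring (2 ^ k)"
    by unfold_locales (use assms in \<open>auto intro: one_less_power\<close>)
  show ?thesis unfolding res_units_eq using assms by (auto simp: coprime_power_right_iff)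
qed

text \<open>The only residue that can match is \<open>x mod 2 ^ k\<close>, and it is a unit exactly
  if \<open>x\<close> is odd.\<close>

lemma sum_units_cong:
  fixes c :: "int \<Rightarrow> complex"
  assumes "k \<ge> 1"
  shows "(\<Sum>m\<in>Units (residue_ring (2 ^ k)). c m * of_bool [x = m] (mod 2 ^ k)) =
    (if odd x then c (x mod 2 ^ k) else 0)"
proof -
  have parity: "even x \<longleftrightarrow> even y" if "[x = y] (mod 2 ^ k)" for y :: int
  proof -
    have "(2::int) dvd 2 ^ k" using assms by simp
    then have "[x = y] (mod 2)" using that cong_dvd_modulus by blast
    then show ?thesis by (simp add: cong_def even_iff_mod_2_eq_zero)
  qed
  have U: "finite (Units (residue_ring (2 ^ k)))"
    unfolding Units_residue_ring_power_2[OF assms] by (rule finite_subset[of _ "{0..2 ^ k}"]) auto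
  have *: "c m * of_bool [x = m] (mod 2 ^ k) = (if m = x mod 2 ^ k then c m else 0)"
    if "m \<in> Units (residue_ring (2 ^ k))" for m
    using that unfolding Units_residue_ring_power_2[OF assms] by (auto simp: cong_def)
  have "x mod 2 ^ k \<in> Units (residue_ring (2 ^ k)) \<longleftrightarrow> odd x"
  proof -
    define y where "y = x mod 2 ^ k"
    have "odd y \<longleftrightarrow> odd x" unfolding y_def using parity[of "x mod 2 ^ k"] by (simp add: cong_def)
    moreover have "y \<ge> 0" "y < 2 ^ k" by (simp_all add: y_def)
    moreover have "y \<noteq> 0" if "odd y" using that by auto
    ultimately show ?thesis
      unfolding Units_residue_ring_power_2[OF assms] y_def[symmetric] by force
  qed
  then show ?thesis using U by (simp add: * cong: sum.cong)
qed

text \<open>This turns the combination into one series with explicit coefficients, to which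
  uniqueness applies.\<close>

lemma sum_E2_hat_sieve:
  assumes "k \<ge> 1" "Im \<tau> > 0"
  shows "(\<Sum>m\<in>Units (residue_ring (2 ^ k)). c m * E2_hat_sieve (2 ^ k) m \<tau>) =
    sigma_series (\<lambda>n. - 24 * (if odd n then c (int n mod 2 ^ k) else 0)) \<tau>"
proof -
  have "(\<Sum>m\<in>Units (residue_ring (2 ^ k)). c m * E2_hat_sieve (2 ^ k) m \<tau>) =
      (\<Sum>m\<in>Units (residue_ring (2 ^ k)). (- 24 * c m) * sigma_series (\<lambda>n. of_bool [int n = m] (mod 2 ^ k)) \<tau>)"
    using assms by (intro sum.cong refl)
      (auto simp: Units_residue_ring_power_2 E2_hat_sieve_eq_sigma_series)
  also have "\<dots> = sigma_series (\<lambda>n. \<Sum>m\<in>Units (residue_ring (2 ^ k)).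
      (- 24 * c m) * of_bool [int n = m] (mod 2 ^ k)) \<tau>"
    by (rule sigma_series_sum[OF assms(2), of _ _ "\<lambda>_. 1"]) simp
  also have "\<dots> = sigma_series (\<lambda>n. - 24 * (if odd n then c (int n mod 2 ^ k) else 0)) \<tau>"
    using sum_units_cong[OF assms(1), of c "int _"]
    by (simp only: mult.assoc sum_distrib_left[symmetric] even_of_nat)
  finally show ?thesis .
qed

text \<open>Comparison with the unslashed series reads invariance off as equality of
  \<open>c\<close> at \<open>n\<close> and at \<open>d^2 n\<close> for odd \<open>n\<close>, where
  \<open>d\<close> is the lower right entry.\<close>

lemma slash_sum_E2_hat_sieve:
  fixes A :: "int ^ 2 ^ 2"
  assumes "k \<ge> 1" "Im \<tau> > 0" "A \<in> Gamma0 (2 ^ (2 * k))" "odd (A $ 2 $ 2)"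
  shows "slash 2 (\<lambda>\<tau>. \<Sum>m\<in>Units (residue_ring (2 ^ k)). c m * E2_hat_sieve (2 ^ k) m \<tau>) A \<tau> =
    sigma_series (\<lambda>n. - 24 * (if odd n then c ((A $ 2 $ 2) ^ 2 * int n mod 2 ^ k) else 0)) \<tau>"
proof -
  have A: "A \<in> Gamma0 ((2 ^ k) ^ 2)" using assms(3) by (simp add: power_mult[symmetric] mult.commute)
  have "slash 2 (\<lambda>\<tau>. \<Sum>m\<in>Units (residue_ring (2 ^ k)). c m * E2_hat_sieve (2 ^ k) m \<tau>) A \<tau> =
      (\<Sum>m\<in>Units (residue_ring (2 ^ k)). c m * slash 2 (E2_hat_sieve (2 ^ k) m) A \<tau>)"
    unfolding slash_def by (simp only: sum_distrib_left mult.left_commute)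
  also have "\<dots> = (\<Sum>m\<in>Units (residue_ring (2 ^ k)). (- 24 * c m) *
      sigma_series (\<lambda>n. of_bool [(A $ 2 $ 2) ^ 2 * int n = m] (mod 2 ^ k)) \<tau>)"
    using assms by (intro sum.cong refl)
      (auto simp: Units_residue_ring_power_2 slash_E2_hat_sieve[OF A])
  also have "\<dots> = sigma_series (\<lambda>n. \<Sum>m\<in>Units (residue_ring (2 ^ k)).
      (- 24 * c m) * of_bool [(A $ 2 $ 2) ^ 2 * int n = m] (mod 2 ^ k)) \<tau>"
    by (rule sigma_series_sum[OF assms(2), of _ _ "\<lambda>_. 1"]) simp
  also have "\<dots> = sigma_series (\<lambda>n. - 24 * (if odd n then c ((A $ 2 $ 2) ^ 2 * int n mod 2 ^ k) else 0)) \<tau>"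
    using sum_units_cong[OF assms(1), of c "(A $ 2 $ 2) ^ 2 * int _"] assms(4)
    by (simp only: mult.assoc sum_distrib_left[symmetric] even_of_nat even_mult_iff even_power) simp
  finally show ?thesis .
qed

section \<open>Odd squares modulo powers of two\<close>

text \<open>With \<open>d = 2 k + 1\<close>, \<open>d^2 - 1 = 4 k (k + 1)\<close>, and one of two
  consecutive integers is even.\<close>

lemma odd_square_cong_1:
  fixes d :: int
  assumes "odd d"
  shows "[d ^ 2 = 1] (mod 8)"
proof -
  obtain k where k: "d = 2 * k + 1" using assms by (elim oddE)
  have "even (k * (k + 1))" by simp
  then obtain l where "k * (k + 1) = 2 * l" by (elim evenE)
  then have "d ^ 2 - 1 = 8 * l" by (simp add: k power2_eq_square algebra_simps)
  then show ?thesis by (simp add: cong_iff_dvd_diff)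
qed

text \<open>Hensel lifting: replacing \<open>d\<close> by \<open>d + 2\<^sup>k\<^sup>-\<^sup>1\<close> changes \<open>d\<^sup>2 r\<close> by
  \<open>2\<^sup>k d r\<close> modulo \<open>2\<^sup>k\<^sup>+\<^sup>1\<close> as soon as \<open>k \<ge> 3\<close>.\<close>

lemma exists_odd_square_mult_cong:
  fixes r s :: int
  assumes "odd r" "[r = s] (mod 8)"
  shows "\<exists>d. odd d \<and> [d ^ 2 * r = s] (mod 2 ^ (k + 3))"
proof (induction k)
  case 0
  show ?case using assms by (intro exI[of _ 1]) simp
next
  case (Suc k)
  then obtain d t where d: "odd d" and t: "d ^ 2 * r - s = 2 ^ (k + 3) * t"
    by (auto simp: cong_iff_dvd_diff)
  show ?case
  proof (cases "even t")
    case True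
    then obtain l where "t = 2 * l" by (elim evenE)
    then have "d ^ 2 * r - s = 2 ^ (Suc k + 3) * l" unfolding t by (simp only: add_Suc power_Suc mult_ac)
    then show ?thesis using d by (intro exI[of _ d]) (simp add: cong_iff_dvd_diff)
  next
    case False
    \<comment> \<open>The correction adds \<open>d * r\<close> to the quotient \<open>t\<close>;
      both are odd, which gains one factor \<open>2\<close>.\<close>
    have "even (t + d * r)" using False d assms(1) by simp
    then obtain l where l: "t + d * r = 2 * l" by (elim evenE)
    have "(d + 2 ^ (k + 2)) ^ 2 * r - s = (d ^ 2 * r - s) + 2 ^ (k + 3) * (d * r) + 2 ^ (Suc k + 3) * (2 ^ k * r)"
      by (simp add: power2_eq_square algebra_simps power_add)
    also have "\<dots> = 2 ^ (k + 3) * (t + d * r) + 2 ^ (Suc k + 3) * (2 ^ k * r)"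
      by (simp add: t distrib_left)
    also have "\<dots> = 2 ^ (Suc k + 3) * (l + 2 ^ k * r)"
      by (simp add: l power_add algebra_simps)
    finally show ?thesis using d
      by (intro exI[of _ "d + 2 ^ (k + 2)"]) (simp add: cong_iff_dvd_diff)
  qed
qed

text \<open>An odd \<open>d\<close> is coprime to \<open>2 ^ k\<close>, so Bezout coefficients
  complete it to a matrix; thus invariance constrains \<open>c\<close> for all odd squares.\<close>

lemma exists_Gamma0_lower_right:
  fixes d :: int
  assumes "odd d"
  obtains A :: "int ^ 2 ^ 2" where "A \<in> Gamma0 (2 ^ k)" "A $ 2 $ 2 = d"
proof -
  have "coprime d (2 ^ k)" using assms by (simp add: coprime_power_right_iff)
  then obtain a b where "a * d + b * 2 ^ k = 1"
    using bezout_int[of d "2 ^ k"] by auto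
  then have "(vector [vector [a, - b], vector [2 ^ k, d]] :: int ^ 2 ^ 2) \<in> Gamma0 (2 ^ k)"
    by (simp add: Gamma0_def SL2Z_def det_2 cong_0_iff)
  then show thesis by (rule that) simp
qed

lemma Gamma0_lower_right_odd:
  fixes A :: "int ^ 2 ^ 2"
  assumes "A \<in> Gamma0 N" "even N"
  shows "odd (A $ 2 $ 2)"
proof
  assume "even (A $ 2 $ 2)"
  moreover have "even (A $ 2 $ 1)"
    using assms by (auto simp: Gamma0_def cong_0_iff intro: dvd_trans[of 2 "int N"])
  ultimately have "even (det A)" by (simp add: det_2)
  then show False using assms by (simp add: Gamma0_def SL2Z_def)
qed

section \<open>Equivalence of invariance and membership in the span\<close>

theorem theorem24:
  fixes n :: nat and c :: "int \<Rightarrow> complex" and f :: "complex \<Rightarrow> complex"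
  assumes "n \<ge> 1"
    and "f = (\<lambda>\<tau>. \<Sum>m\<in>Units (residue_ring (2 ^ n)). c m * E2_hat_sieve (2 ^ n) m \<tau>)"
    and "f \<in> modular_forms 2 (Gamma1 (2 ^ (2 * n)))"
  shows "f \<in> modular_forms 2 (Gamma0 (2 ^ (2 * n))) \<longleftrightarrow>
    f \<in> cfun.span {E2_hat_sieve (2 ^ j) m | j m.
          j \<in> {1..min 3 n} \<and> m \<in> Units (residue_ring (2 ^ j))}"
proof -
  \<comment> \<open>Vanishing outside the half plane, holomorphy and the cusp conditions do not
    mention the group and come from the assumption on \<open>Gamma1\<close>; only invariance is
    left.\<close>
  have inv_iff: "f \<in> modular_forms 2 (Gamma0 (2 ^ (2 * n))) \<longleftrightarrow>
      (\<forall>A\<in>Gamma0 (2 ^ (2 * n)). \<forall>\<tau>. Im \<tau> > 0 \<longrightarrow> slash 2 f A \<tau> = f \<tau>)"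
    using assms(3) by (auto simp: modular_forms_def upper_half_plane_def)
  have odd_entry: "odd (A $ 2 $ 2)" if "A \<in> Gamma0 (2 ^ (2 * n))" for A :: "int ^ 2 ^ 2"
    using Gamma0_lower_right_odd[OF that] assms(1) by simp
  show ?thesis
  proof
    assume "f \<in> modular_forms 2 (Gamma0 (2 ^ (2 * n)))"
    then have inv: "slash 2 f A \<tau> = f \<tau>" if "A \<in> Gamma0 (2 ^ (2 * n))" "Im \<tau> > 0" for A \<tau>
      using inv_iff that by blast
    \<comment> \<open>Uniqueness of coefficients asks for a uniform bound; \<open>c\<close> is
      evaluated at finitely many residues only.\<close>
    define B where "B = (\<Sum>m\<in>{0..<2 ^ n}. norm (c m))"
    have bound: "norm (- 24 * (if P then c (x mod 2 ^ n) else 0)) \<le> 24 * B" for x P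
    proof -
      have "norm (c (x mod 2 ^ n)) \<le> B" unfolding B_def
        by (rule member_le_sum) auto
      moreover have "B \<ge> 0" unfolding B_def by (intro sum_nonneg) auto
      ultimately show ?thesis by (simp add: norm_mult)
    qed
    \<comment> \<open>Invariance under a matrix with lower right entry \<open>d\<close>, compared at
      the index \<open>r\<close>.\<close>
    have square: "c (int r mod 2 ^ n) = c (d ^ 2 * int r mod 2 ^ n)" if rd: "odd r" "odd d" for r d
    proof -
      obtain A :: "int ^ 2 ^ 2" where A: "A \<in> Gamma0 (2 ^ (2 * n))" "A $ 2 $ 2 = d"
        using exists_Gamma0_lower_right[OF rd(2)] by blast
      have "- 24 * (if odd r then c (int r mod 2 ^ n) else 0) =
          - 24 * (if odd r then c (d ^ 2 * int r mod 2 ^ n) else 0)"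
      proof (rule sigma_series_eq_imp[OF _ bound bound])
        fix \<tau> :: complex assume \<tau>: "Im \<tau> > 0"
        show "sigma_series (\<lambda>r. - 24 * (if odd r then c (int r mod 2 ^ n) else 0)) \<tau> =
            sigma_series (\<lambda>r. - 24 * (if odd r then c (d ^ 2 * int r mod 2 ^ n) else 0)) \<tau>"
          using inv[OF A(1) \<tau>] slash_sum_E2_hat_sieve[OF assms(1) \<tau> A(1) odd_entry[OF A(1)], of c]
            sum_E2_hat_sieve[OF assms(1) \<tau>, of c]
          by (simp only: assms(2) A(2))
      qed (use rd in \<open>auto intro: odd_pos\<close>)
      then show ?thesis using rd by simp
    qed
    define j where "j = min 3 n"
    have j: "j \<ge> 1" "j \<le> n" using assms(1) by (auto simp: j_def)
    have period: "c (int r mod 2 ^ n) = c (int r mod 2 ^ j)" if "odd r" for r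
    proof (cases "n \<le> 3")
      case True
      then show ?thesis by (simp add: j_def)
    next
      case False
      then have j3: "j = 3" by (simp add: j_def)
      \<comment> \<open>The target is the small representative \<open>int r mod 8\<close>, so that
        all odd \<open>r\<close> in one class modulo \<open>8\<close> get the same value.\<close>
      have "\<exists>d. odd d \<and> [d ^ 2 * int r = int r mod 8] (mod 2 ^ (n - 3 + 3))"
        by (rule exists_odd_square_mult_cong) (use that in \<open>auto simp: cong_def\<close>)
      then obtain d where d: "odd d" "[d ^ 2 * int r = int r mod 8] (mod 2 ^ n)"
        using False by auto
      have "(8::int) \<le> 2 ^ n" using power_increasing[of 3 n "2::int"] False by simp
      then have "int r mod 8 mod 2 ^ n = int r mod 8"
        by (intro mod_pos_pos_trivial) (auto intro: less_le_trans[OF pos_mod_bound])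
      then show ?thesis using square[OF that d(1)] d(2) by (simp add: cong_def j3)
    qed
    \<comment> \<open>The same values of \<open>c\<close> serve as coefficients, and the top level
      \<open>j\<close> alone suffices.\<close>
    have "f = (\<Sum>m\<in>Units (residue_ring (2 ^ j)). cfun_scale (c m) (E2_hat_sieve (2 ^ j) m))"
    proof
      fix \<tau>
      have sum_apply: "(\<Sum>i\<in>I. g i) \<tau> = (\<Sum>i\<in>I. g i \<tau>)" for I :: "int set" and g :: "int \<Rightarrow> complex \<Rightarrow> complex"
        by (induction I rule: infinite_finite_induct) auto
      have "f \<tau> = (\<Sum>m\<in>Units (residue_ring (2 ^ j)). c m * E2_hat_sieve (2 ^ j) m \<tau>)"
      proof (cases "Im \<tau> > 0")
        case True
        have "(\<lambda>r. - 24 * (if odd r then c (int r mod 2 ^ n) else 0)) =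
            (\<lambda>r. - 24 * (if odd r then c (int r mod 2 ^ j) else 0))"
          using period by auto
        then show ?thesis
          unfolding assms(2) sum_E2_hat_sieve[OF assms(1) True] sum_E2_hat_sieve[OF j(1) True] by (simp only:)
      next
        case False
        then show ?thesis by (simp add: assms(2) E2_hat_sieve_def upper_half_plane_def)
      qed
      then show "f \<tau> = (\<Sum>m\<in>Units (residue_ring (2 ^ j)). cfun_scale (c m) (E2_hat_sieve (2 ^ j) m)) \<tau>"
        by (simp add: cfun_scale_def sum_apply)
    qed
    also have "\<dots> \<in> cfun.span {E2_hat_sieve (2 ^ j) m | j m.
          j \<in> {1..min 3 n} \<and> m \<in> Units (residue_ring (2 ^ j))}"
    proof (intro cfun.span_sum cfun.span_scale cfun.span_base)
      fix m assume "m \<in> Units (residue_ring (2 ^ j))"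
      moreover have "j \<in> {1..min 3 n}" using assms(1) by (simp add: j_def)
      ultimately show "E2_hat_sieve (2 ^ j) m \<in> {E2_hat_sieve (2 ^ j) m | j m.
          j \<in> {1..min 3 n} \<and> m \<in> Units (residue_ring (2 ^ j))}" by blast
    qed
    finally show "f \<in> cfun.span {E2_hat_sieve (2 ^ j) m | j m.
          j \<in> {1..min 3 n} \<and> m \<in> Units (residue_ring (2 ^ j))}" .
  next
    assume f: "f \<in> cfun.span {E2_hat_sieve (2 ^ j) m | j m.
          j \<in> {1..min 3 n} \<and> m \<in> Units (residue_ring (2 ^ j))}"
    have "slash 2 f A \<tau> = f \<tau>" if A: "A \<in> Gamma0 (2 ^ (2 * n))" and \<tau>: "Im \<tau> > 0" for A \<tau>
    proof -
      \<comment> \<open>For fixed \<open>A\<close> and \<open>\<tau>\<close> invariance is linear in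
        the function, so it need only be checked on the generators.\<close>
      have "cfun.subspace {g. slash 2 g A \<tau> = g \<tau>}"
        by (auto simp: cfun.subspace_def slash_def cfun_scale_def algebra_simps)
      moreover have "E2_hat_sieve (2 ^ j) m \<in> {g. slash 2 g A \<tau> = g \<tau>}"
        if j: "j \<in> {1..min 3 n}" and m: "m \<in> Units (residue_ring (2 ^ j))" for j m
      proof -
        have "(2::int) ^ (2 * j) dvd 2 ^ (2 * n)" using j by (intro le_imp_power_dvd) auto
        then have "A \<in> Gamma0 (2 ^ (2 * j))"
          using A by (auto simp: Gamma0_def intro: cong_dvd_modulus)
        then have A': "A \<in> Gamma0 ((2 ^ j) ^ 2)" by (simp add: power_mult[symmetric] mult.commute)
        have m': "odd m" using m j by (simp add: Units_residue_ring_power_2)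
        have j': "even (2 ^ j :: nat)" "(2 ^ j :: nat) > 0" using j by auto
        \<comment> \<open>Since \<open>j <= 3\<close>, the modulus divides \<open>8\<close>, modulo
          which odd squares are \<open>1\<close>.\<close>
        have "(2::int) ^ j dvd 2 ^ 3" using j by (intro le_imp_power_dvd) auto
        then have "[(A $ 2 $ 2) ^ 2 = 1] (mod 2 ^ j)"
          using odd_square_cong_1[OF odd_entry[OF A]] cong_dvd_modulus by force
        then have "[(A $ 2 $ 2) ^ 2 * x = x] (mod 2 ^ j)" for x
          using cong_scalar_right[of "(A $ 2 $ 2) ^ 2" 1 "2 ^ j" x] by simp
        then have "[(A $ 2 $ 2) ^ 2 * x = m] (mod 2 ^ j) \<longleftrightarrow> [x = m] (mod 2 ^ j)" for x
          by (metis cong_sym cong_trans)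
        then show ?thesis
          by (simp add: slash_E2_hat_sieve[OF A' j' m' \<tau>] E2_hat_sieve_eq_sigma_series[OF \<tau> j'(1) m'])
      qed
      ultimately have "cfun.span {E2_hat_sieve (2 ^ j) m | j m.
          j \<in> {1..min 3 n} \<and> m \<in> Units (residue_ring (2 ^ j))} \<subseteq> {g. slash 2 g A \<tau> = g \<tau>}"
        by (intro cfun.span_minimal) auto
      then show ?thesis using f by blast
    qed
    then show "f \<in> modular_forms 2 (Gamma0 (2 ^ (2 * n)))" using inv_iff by blast
  qed
qed

end
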